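(* There exists a $6$-dimensional space-filling zonotope whose belt diameter is equal to $3$. Consequently, for $d=6$ the upper bounds $\lceil\log_2 d\rceil$ and $\left\lceil\log_2\left(\tfrac45 d\right)\right\rceil$ for the belt diameter of $d$-dimensional space-filling zonotopes are sharp (both equal $3$ and are attained).
   Context: Zonotope: for a finite set of vectors $V=\{\mathbf v_1,\ldots,\mathbf v_n\}\subset\mathbb{R}^d$, $Z(V)=Z(\mathbf v_1,\ldots,\mathbf v_n)$ denotes the Minkowski sum of the segments $[\mathbf 0,\mathbf v_i]$, $i=1,\ldots,n$; polytopes of this form (up to translation) are called zonotopes. A $d$-dimensional polytope in $\mathbb{R}^d$ is a parallelohedron if $\mathbb{R}^d$ can be tiled by its translates. A space-filling zonotope is a zonotope that is a parallelohedron. Belts: let $P$ be a $d$-dimensional polytope with centrally symmetric facets (every zonotope is such a polytope). A facet is a face of dimension $d-1$, a ridge is a (nonempty) face of dimension $d-2$. For a ridge $R$ of $P$, the belt of $P$ corresponding to $R$ is the set of all facets of $P$ parallel to $R$ (i.e. facets whose direction space contains the direction space of $R$). A belt path of length $n$ on $P$ is a sequence $F_0,\mathcal{B}_1,F_1,\mathcal{B}_2,\ldots,\mathcal{B}_n,F_n$ of facets $F_i$ and belts $\mathcal{B}_i$ such that each belt $\mathcal{B}_i$ contains the facets $F_{i-1}$ and $F_i$; it connects $F_0$ and $F_n$. The belt distance $d_{\mathcal B}^P(F,G)$ between facets $F$ and $G$ is the smallest $n$ for which there is a belt path of length $n$ connecting $F$ and $G$, except that the belt distance between two opposite facets (symmetric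 to each other with respect to the center of $P$) is set to be $0$. The belt diameter of $P$ is the maximal belt distance between two facets of $P$. *)

theory Defs
  imports "HOL-Analysis.Analysis"
begin

(* The sum is the Minkowski sum of sets (HOL-Library.Set_Algebras). *)
definition minkowski_zonotope :: "'a::euclidean_space set \<Rightarrow> 'a set" where
  "minkowski_zonotope V = (\<Sum>v\<in>V. closed_segment 0 v)"

definition zonotope :: "'a::euclidean_space set \<Rightarrow> bool" where
  "zonotope Z \<longleftrightarrow> (\<exists>V t. finite V \<and> Z = (+) t ` minkowski_zonotope V)"

definition tiles_by_translates :: "'a::euclidean_space set \<Rightarrow> 'a set \<Rightarrow> bool" where
  "tiles_by_translates P T \<longleftrightarrow>
     (\<Union>t\<in>T. (+) t ` P) = UNIV \<and>
     (\<forall>s\<in>T. \<forall>t\<in>T. s \<noteq> t \<longrightarrow> interior ((+) s ` P) \<inter> interior ((+) t ` P) = {})"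

(* The translation set T is arbitrary: the tiling need be neither a lattice
   tiling nor face-to-face. *)
definition parallelohedron :: "'a::euclidean_space set \<Rightarrow> bool" where
  "parallelohedron P \<longleftrightarrow>
     polytope P \<and> aff_dim P = int DIM('a) \<and> (\<exists>T. tiles_by_translates P T)"

definition space_filling_zonotope :: "'a::euclidean_space set \<Rightarrow> bool" where
  "space_filling_zonotope Z \<longleftrightarrow> zonotope Z \<and> parallelohedron Z"

definition ridge_of :: "'a::euclidean_space set \<Rightarrow> 'a set \<Rightarrow> bool" (infixr \<open>(ridge'_of)\<close> 50) where
  "R ridge_of P \<longleftrightarrow> R face_of P \<and> R \<noteq> {} \<and> aff_dim R = aff_dim P - 2"

definition direction_space :: "'a::euclidean_space set \<Rightarrow> 'a set" where
  "direction_space S = {x - y | x y. x \<in> affine hull S \<and> y \<in> affine hull S}"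

definition belt :: "'a::euclidean_space set \<Rightarrow> 'a set \<Rightarrow> 'a set set" where
  "belt P R = {F. F facet_of P \<and> direction_space R \<subseteq> direction_space F}"

definition belts :: "'a::euclidean_space set \<Rightarrow> 'a set set set" where
  "belts P = {belt P R | R. R ridge_of P}"

(* The path F 0, B 1, F 1, ..., B n, F n; values of F beyond n, and of B outside
   {1..n}, are irrelevant. *)
definition belt_path ::
    "'a::euclidean_space set \<Rightarrow> nat \<Rightarrow> (nat \<Rightarrow> 'a set) \<Rightarrow> (nat \<Rightarrow> 'a set set) \<Rightarrow> bool" where
  "belt_path P n F B \<longleftrightarrow>
     (\<forall>i\<le>n. F i facet_of P) \<and>
     (\<forall>i\<in>{1..n}. B i \<in> belts P \<and> F (i - 1) \<in> B i \<and> F i \<in> B i)"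

(* The point reflection of P in c is x \<mapsto> 2c - x; for a nonempty bounded P at
   most one centre c exists. *)
definition opposite_facets :: "'a::euclidean_space set \<Rightarrow> 'a set \<Rightarrow> 'a set \<Rightarrow> bool" where
  "opposite_facets P F G \<longleftrightarrow>
     F facet_of P \<and> G facet_of P \<and>
     (\<exists>c. (\<lambda>x. 2 *\<^sub>R c - x) ` P = P \<and> G = (\<lambda>x. 2 *\<^sub>R c - x) ` F)"

(* Valued in enat so that facets joined by no belt path are at distance \<infinity>;
   Inf of a nonempty set of extended naturals is its least element. *)
definition belt_distance :: "'a::euclidean_space set \<Rightarrow> 'a set \<Rightarrow> 'a set \<Rightarrow> enat" where
  "belt_distance P F G =
     (if opposite_facets P F G then 0
      else Inf {enat n | n. \<exists>\<F> \<B>. belt_path P n \<F> \<B> \<and> \<F> 0 = F \<and> \<F> n = G})"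

(* For a polytope the set is finite, so the supremum is a maximum. *)
definition belt_diameter :: "'a::euclidean_space set \<Rightarrow> enat" where
  "belt_diameter P = Sup {belt_distance P F G | F G. F facet_of P \<and> G facet_of P}"

end

theory Submission
  imports Defs
begin

text \<open>
  The zonotope is the one of the cographic matroid of the complete graph \<open>K\<^sub>5\<close>, whose cycle space has
  dimension \<open>10 - 5 + 1 = 6\<close>. Points \<open>x\<close> of the space, read as linear functionals, are circulations
  on \<open>K\<^sub>5\<close>, and the generator of an edge reads off the flow through that edge.

  It fills space because the system of generators is regular: every circulation contains a directed
  cycle conformal to it (\<open>circulation_contains_directed_cycle\<close>), and the flow of a cycle has entries in
  \<open>{-1, 0, 1}\<close>. For such systems the zonotope is the Voronoi cell of the lattice of integral
  circulations in disguise, and its lattice translates tile (\<open>regular_zonotope_tiles\<close>).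

  A face is exposed by a functional, and its direction space is spanned by the generators on which the
  functional vanishes. Facet normals are therefore circulations supported on a single cycle, so
  pairs of opposite facets are cycles of \<open>K\<^sub>5\<close>. Two facets lie in a common belt exactly if the union of
  their cycles carries at most two independent circulations (\<open>share_belt_dim\<close>, \<open>share_beltI\<close>).

  The diameter is at most 3: every cycle has at most five vertices, a chord cuts off a triangle in a
  common belt, and any two triangles meet and hence share a belt. It is at least 3: the pentagon and the
  pentagram are complementary Hamiltonian cycles. A cycle sharing a belt with a Hamiltonian cycle uses
  at most one edge outside it, so a common neighbour of both would have at most two edges.
\<close>

section \<open>Faces of zonotopes\<close>

lemma minkowski_zonotope_eq:
  assumes "finite V"
  shows "minkowski_zonotope V = {\<Sum>v\<in>V. l v *\<^sub>R v | l. \<forall>v\<in>V. 0 \<le> l v \<and> l v \<le> 1}"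
proof -
  have "minkowski_zonotope V = {sum s V | s. \<forall>v\<in>V. s v \<in> closed_segment 0 v}"
    unfolding minkowski_zonotope_def by (rule set_sum_alt[OF assms])
  also have "\<dots> = {\<Sum>v\<in>V. l v *\<^sub>R v | l. \<forall>v\<in>V. 0 \<le> l v \<and> l v \<le> 1}"
  proof (intro equalityI subsetI)
    fix x assume "x \<in> {sum s V | s. \<forall>v\<in>V. s v \<in> closed_segment 0 v}"
    then obtain s where x: "x = sum s V" and s: "\<And>v. v \<in> V \<Longrightarrow> s v \<in> closed_segment 0 v"
      by blast
    have "\<forall>v\<in>V. \<exists>l. s v = l *\<^sub>R v \<and> 0 \<le> l \<and> l \<le> 1"
      using s by (force simp: in_segment)
    then obtain l where "\<forall>v\<in>V. s v = l v *\<^sub>R v \<and> 0 \<le> l v \<and> l v \<le> 1"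
      by metis
    then show "x \<in> {\<Sum>v\<in>V. l v *\<^sub>R v | l. \<forall>v\<in>V. 0 \<le> l v \<and> l v \<le> 1}"
      using x by (auto intro!: exI[of _ l] sum.cong)
  next
    fix x assume "x \<in> {\<Sum>v\<in>V. l v *\<^sub>R v | l. \<forall>v\<in>V. 0 \<le> l v \<and> l v \<le> 1}"
    then obtain l where "x = (\<Sum>v\<in>V. l v *\<^sub>R v)" "\<forall>v\<in>V. 0 \<le> l v \<and> l v \<le> 1"
      by blast
    then show "x \<in> {sum s V | s. \<forall>v\<in>V. s v \<in> closed_segment 0 v}"
      by (auto simp: in_segment intro!: exI[of _ "\<lambda>v. l v *\<^sub>R v"])
  qed
  finally show ?thesis .
qed

lemma polytope_minkowski_zonotope:
  assumes "finite V"
  shows "polytope (minkowski_zonotope V)"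
proof -
  have "finite (\<Sum>v\<in>V. {0, v})"
    using assms by (induction V) (auto simp: finite_set_plus)
  moreover have "minkowski_zonotope V = convex hull (\<Sum>v\<in>V. {0, v})"
    by (simp add: minkowski_zonotope_def convex_hull_set_sum segment_convex_hull)
  ultimately show ?thesis by (simp add: polytope_convex_hull)
qed

lemma zero_in_minkowski_zonotope: "finite V \<Longrightarrow> 0 \<in> minkowski_zonotope V"
  by (force simp: minkowski_zonotope_eq intro!: exI[of _ "\<lambda>_. 0"])

lemma generator_in_minkowski_zonotope:
  assumes "finite V" "v \<in> V"
  shows "v \<in> minkowski_zonotope V"
proof -
  have "(\<Sum>w\<in>V. of_bool (w = v) *\<^sub>R w) = (\<Sum>w\<in>V. if w = v then w else 0)"
    by (intro sum.cong) auto
  then have "v = (\<Sum>w\<in>V. of_bool (w = v) *\<^sub>R w)"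
    using assms by simp
  then show ?thesis
    using assms(1) by (force simp: minkowski_zonotope_eq intro!: exI[of _ "\<lambda>w. of_bool (w = v)"])
qed

lemma affine_hull_minkowski_zonotope:
  assumes "finite V"
  shows "affine hull (minkowski_zonotope V) = span V"
proof -
  have "affine hull (minkowski_zonotope V) = span (minkowski_zonotope V)"
    by (rule affine_hull_span_0) (simp add: hull_inc zero_in_minkowski_zonotope assms)
  also have "\<dots> = span V"
  proof (rule span_eq[THEN iffD2], intro conjI subsetI)
    fix x assume "x \<in> minkowski_zonotope V"
    then show "x \<in> span V"
      by (auto simp: minkowski_zonotope_eq assms intro!: span_sum span_scale intro: span_base)
  next
    fix x assume "x \<in> V"
    then show "x \<in> span (minkowski_zonotope V)"
      by (simp add: assms generator_in_minkowski_zonotope span_base)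
  qed
  finally show ?thesis .
qed

lemma inner_le_zonotope_support:
  assumes "finite V" "x \<in> minkowski_zonotope V"
  shows "a \<bullet> x \<le> (\<Sum>v\<in>V. max 0 (a \<bullet> v))"
proof -
  obtain l where x: "x = (\<Sum>v\<in>V. l v *\<^sub>R v)" and l: "\<forall>v\<in>V. 0 \<le> l v \<and> l v \<le> 1"
    using assms by (auto simp: minkowski_zonotope_eq)
  have "a \<bullet> (l v *\<^sub>R v) \<le> max 0 (a \<bullet> v)" if "v \<in> V" for v
    using l that by (cases "0 \<le> a \<bullet> v") (auto simp: mult_left_le_one_le mult_nonneg_nonpos max_def)
  then show ?thesis
    unfolding x inner_sum_right by (rule sum_mono)
qed

text \<open>
  The maximum of \<open>a \<bullet> x\<close> over the zonotope is the sum of the positive parts of the values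
  \<open>a \<bullet> v\<close>, so this is the face exposed by the functional \<open>a\<close>; for \<open>a = 0\<close> it is the whole zonotope.
\<close>

definition zonotope_face :: "'a::euclidean_space set \<Rightarrow> 'a \<Rightarrow> 'a set" where
  "zonotope_face V a = minkowski_zonotope V \<inter> {x. a \<bullet> x = (\<Sum>v\<in>V. max 0 (a \<bullet> v))}"

text \<open>
  To maximise \<open>a\<close> the coefficient of \<open>v\<close> must be 1 if \<open>a \<bullet> v > 0\<close> and 0 if \<open>a \<bullet> v < 0\<close>; only the
  generators orthogonal to \<open>a\<close> keep their freedom. Hence the dimension and the direction space of a
  face can be read off from the generators on which its functional vanishes.
\<close>

lemma zonotope_face_eq_translate:
  assumes "finite V"
  shows "zonotope_face V a =
    (+) (\<Sum>v | v \<in> V \<and> 0 < a \<bullet> v. v) ` minkowski_zonotope {v \<in> V. a \<bullet> v = 0}"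
    (is "_ = (+) ?c ` minkowski_zonotope ?V0")
proof (intro equalityI subsetI)
  fix x assume "x \<in> zonotope_face V a"
  then obtain l where x: "x = (\<Sum>v\<in>V. l v *\<^sub>R v)" and l: "\<forall>v\<in>V. 0 \<le> l v \<and> l v \<le> 1"
    and ax: "a \<bullet> x = (\<Sum>v\<in>V. max 0 (a \<bullet> v))"
    using assms by (auto simp: zonotope_face_def minkowski_zonotope_eq)
  have le: "l v * (a \<bullet> v) \<le> max 0 (a \<bullet> v)" if "v \<in> V" for v
    using l that by (cases "0 \<le> a \<bullet> v") (auto simp: mult_left_le_one_le mult_nonneg_nonpos max_def)
  have "(\<Sum>v\<in>V. max 0 (a \<bullet> v) - l v * (a \<bullet> v)) = 0"
    using ax by (simp add: x inner_sum_right sum_subtractf)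
  then have eq: "l v * (a \<bullet> v) = max 0 (a \<bullet> v)" if "v \<in> V" for v
    using that le assms by (subst (asm) sum_nonneg_eq_0_iff) auto
  have "x = (\<Sum>v\<in>V. (if 0 < a \<bullet> v then v else 0) + (if a \<bullet> v = 0 then l v *\<^sub>R v else 0))"
    unfolding x
  proof (rule sum.cong)
    fix v assume "v \<in> V"
    from eq[OF this] show "l v *\<^sub>R v = (if 0 < a \<bullet> v then v else 0) + (if a \<bullet> v = 0 then l v *\<^sub>R v else 0)"
      by (cases "a \<bullet> v" "0::real" rule: linorder_cases) (auto simp: max_def)
  qed simp
  then have "x = ?c + (\<Sum>v\<in>?V0. l v *\<^sub>R v)"
    using assms by (simp add: sum.distrib sum.inter_filter)
  moreover have "(\<Sum>v\<in>?V0. l v *\<^sub>R v) \<in> minkowski_zonotope ?V0"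
    using l assms by (auto simp: minkowski_zonotope_eq)
  ultimately show "x \<in> (+) ?c ` minkowski_zonotope ?V0" by blast
next
  fix x assume "x \<in> (+) ?c ` minkowski_zonotope ?V0"
  then obtain l where x: "x = ?c + (\<Sum>v\<in>?V0. l v *\<^sub>R v)"
    and l: "\<forall>v\<in>?V0. 0 \<le> l v \<and> l v \<le> 1"
    using assms by (auto simp: minkowski_zonotope_eq)
  define m where "m v = (if 0 < a \<bullet> v then 1 else if a \<bullet> v = 0 then l v else 0)" for v
  have "m v *\<^sub>R v = (if 0 < a \<bullet> v then v else 0) + (if a \<bullet> v = 0 then l v *\<^sub>R v else 0)" for v
    by (auto simp: m_def)
  then have xm: "x = (\<Sum>v\<in>V. m v *\<^sub>R v)"
    using assms by (simp add: x sum.distrib sum.inter_filter cong: sum.cong)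
  have "a \<bullet> x = (\<Sum>v\<in>V. max 0 (a \<bullet> v))"
    unfolding xm inner_sum_right by (intro sum.cong) (auto simp: m_def max_def)
  moreover have "\<forall>v\<in>V. 0 \<le> m v \<and> m v \<le> 1"
    using l by (auto simp: m_def)
  ultimately show "x \<in> zonotope_face V a"
    using assms xm by (auto simp: zonotope_face_def minkowski_zonotope_eq)
qed

lemma direction_space_zonotope_face:
  assumes "finite V"
  shows "direction_space (zonotope_face V a) = span {v \<in> V. a \<bullet> v = 0}"
proof -
  let ?S = "span {v \<in> V. a \<bullet> v = 0}"
  obtain c where c: "affine hull (zonotope_face V a) = (+) c ` ?S"
    using assms by (simp add: zonotope_face_eq_translate affine_hull_translation
        affine_hull_minkowski_zonotope)
  have "direction_space (zonotope_face V a) = {(c + x) - (c + y) | x y. x \<in> ?S \<and> y \<in> ?S}"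
    unfolding direction_space_def c by blast
  also have "\<dots> = {x - y | x y. x \<in> ?S \<and> y \<in> ?S}"
    by simp
  also have "\<dots> = ?S"
  proof (intro equalityI subsetI)
    fix x assume "x \<in> ?S"
    then show "x \<in> {x - y | x y. x \<in> ?S \<and> y \<in> ?S}"
      using span_0[of "{v \<in> V. a \<bullet> v = 0}"] by (metis (mono_tags, lifting) diff_zero mem_Collect_eq)
  qed (auto intro: span_diff)
  finally show ?thesis .
qed

lemma aff_dim_zonotope_face:
  assumes "finite V"
  shows "aff_dim (zonotope_face V a) = int (dim {v \<in> V. a \<bullet> v = 0})"
  using assms
  by (simp add: zonotope_face_eq_translate aff_dim_translation_eq
      affine_hull_minkowski_zonotope aff_dim_subspace
      flip: aff_dim_affine_hull[of "minkowski_zonotope _"])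

lemma aff_dim_minkowski_zonotope:
  assumes "finite V"
  shows "aff_dim (minkowski_zonotope V) = int (dim V)"
  using assms
  by (simp add: affine_hull_minkowski_zonotope aff_dim_subspace flip: aff_dim_affine_hull[of "minkowski_zonotope _"])

lemma zonotope_face_nonempty:
  assumes "finite V"
  shows "zonotope_face V a \<noteq> {}"
  using assms zero_in_minkowski_zonotope[of "{v \<in> V. a \<bullet> v = 0}"]
  by (auto simp: zonotope_face_eq_translate)

text \<open>
  Faces of a polytope are exposed, so every nonempty face comes from a functional. From here on faces
  are handled through their functionals only.
\<close>

lemma face_of_minkowski_zonotope_iff:
  assumes "finite V"
  shows "F face_of minkowski_zonotope V \<and> F \<noteq> {} \<longleftrightarrow> (\<exists>a. F = zonotope_face V a)"
proof (intro iffI)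
  let ?Z = "minkowski_zonotope V"
  assume F0: "F face_of ?Z \<and> F \<noteq> {}"
  then have "F exposed_face_of ?Z"
    using exposed_face_of_polyhedron polytope_imp_polyhedron polytope_minkowski_zonotope assms
    by blast
  then obtain a b where ab: "?Z \<subseteq> {x. a \<bullet> x \<le> b}" and F: "F = ?Z \<inter> {x. a \<bullet> x = b}"
    by (auto simp: exposed_face_of_def)
  obtain x where "x \<in> zonotope_face V a"
    using assms zonotope_face_nonempty by blast
  then have "(\<Sum>v\<in>V. max 0 (a \<bullet> v)) \<le> b"
    using ab by (auto simp: zonotope_face_def)
  moreover obtain y where "y \<in> ?Z" "a \<bullet> y = b"
    using F0 F by blast
  then have "b \<le> (\<Sum>v\<in>V. max 0 (a \<bullet> v))"
    using assms inner_le_zonotope_support by blast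
  ultimately have "b = (\<Sum>v\<in>V. max 0 (a \<bullet> v))" by linarith
  then show "\<exists>a. F = zonotope_face V a"
    unfolding F zonotope_face_def by blast
next
  assume "\<exists>a. F = zonotope_face V a"
  then obtain a where F: "F = zonotope_face V a" by blast
  have "zonotope_face V a face_of minkowski_zonotope V"
    unfolding zonotope_face_def
    using assms inner_le_zonotope_support
    by (intro face_of_Int_supporting_hyperplane_le polytope_imp_convex
        polytope_minkowski_zonotope)
  then show "F face_of minkowski_zonotope V \<and> F \<noteq> {}"
    using assms zonotope_face_nonempty F by blast
qed

section \<open>Zonotopes of regular vector systems tile\<close>

lemma inner_spanning_eq_0:
  assumes "span V = UNIV" "\<And>v. v \<in> V \<Longrightarrow> x \<bullet> v = 0"
  shows "x = 0"
proof -
  have "x \<bullet> x = 0"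
    by (rule span_induct[of x V "\<lambda>y. x \<bullet> y = 0"]) (simp_all add: assms subspace_hyperplane)
  then show ?thesis by simp
qed

text \<open>
  This is regularity of the oriented matroid of \<open>V\<close>: a totally unimodular system has this property,
  since below every vector of its row space there lies, conformally, an elementary one with
  entries in \<open>{-1, 0, 1}\<close>.
\<close>

definition regular_vectors :: "'a::euclidean_space set \<Rightarrow> bool" where
  "regular_vectors V \<longleftrightarrow> finite V \<and> span V = UNIV \<and>
     (\<forall>a. a \<noteq> 0 \<longrightarrow> (\<exists>t. t \<noteq> 0 \<and> (\<forall>v\<in>V. t \<bullet> v = 0 \<or> t \<bullet> v = sgn (a \<bullet> v))))"

text \<open>
  Subtracting from \<open>a\<close> the largest multiple of a conformal \<open>{-1, 0, 1}\<close>-valued functional that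
  the signs permit makes some value \<open>a \<bullet> v\<close> vanish. By conformity the support function is additive along this
  subtraction, so the inequality for \<open>a\<close> is a nonnegative combination of inequalities for elementary
  functionals.
\<close>

lemma elementary_inequalities_suffice:
  assumes reg: "regular_vectors V"
    and elem: "\<And>t. \<forall>v\<in>V. t \<bullet> v \<in> {-1, 0, 1} \<Longrightarrow> t \<bullet> z \<le> (\<Sum>v\<in>V. max 0 (t \<bullet> v))"
  shows "a \<bullet> z \<le> (\<Sum>v\<in>V. max 0 (a \<bullet> v))"
proof (induction "card {v \<in> V. a \<bullet> v \<noteq> 0}" arbitrary: a rule: less_induct)
  case less
  have fin: "finite V" and sp: "span V = UNIV"
    using reg by (auto simp: regular_vectors_def)
  show ?case
  proof (cases "a = 0")
    case False
    then obtain t where t0: "t \<noteq> 0" and t: "\<forall>v\<in>V. t \<bullet> v = 0 \<or> t \<bullet> v = sgn (a \<bullet> v)"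
      using reg unfolding regular_vectors_def by blast
    let ?S = "{v \<in> V. t \<bullet> v \<noteq> 0}"
    have "?S \<noteq> {}" using inner_spanning_eq_0[OF sp, of t] t0 by blast
    moreover have "finite ?S" using fin by simp
    ultimately obtain w where w: "w \<in> ?S" and wmin: "\<And>v. v \<in> ?S \<Longrightarrow> \<bar>a \<bullet> w\<bar> \<le> \<bar>a \<bullet> v\<bar>"
      using arg_min_if_finite(1)[of ?S "\<lambda>v. \<bar>a \<bullet> v\<bar>"] arg_min_least[of ?S _ "\<lambda>v. \<bar>a \<bullet> v\<bar>"]
      by blast
    define c where "c = \<bar>a \<bullet> w\<bar>"
    define b where "b = a - c *\<^sub>R t"
    have conf: "max 0 (a \<bullet> v) = c * max 0 (t \<bullet> v) + max 0 (b \<bullet> v) \<and> (a \<bullet> v = 0 \<longrightarrow> b \<bullet> v = 0)"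
      if v: "v \<in> V" for v
    proof (cases "t \<bullet> v = 0")
      case False
      then have "c \<le> \<bar>a \<bullet> v\<bar>" "0 \<le> c" "t \<bullet> v = sgn (a \<bullet> v)"
        using wmin v t by (auto simp: c_def)
      then show ?thesis
        by (auto simp: b_def inner_diff_left sgn_if max_def split: if_splits)
    qed (auto simp: b_def inner_diff_left)
    have "t \<bullet> w = sgn (a \<bullet> w)" "t \<bullet> w \<noteq> 0" using w t by auto
    then have "b \<bullet> w = 0" "a \<bullet> w \<noteq> 0"
      by (auto simp: b_def c_def inner_diff_left sgn_if abs_if split: if_splits)
    then have "{v \<in> V. b \<bullet> v \<noteq> 0} \<subset> {v \<in> V. a \<bullet> v \<noteq> 0}"
      using conf w by blast
    then have "card {v \<in> V. b \<bullet> v \<noteq> 0} < card {v \<in> V. a \<bullet> v \<noteq> 0}"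
      using fin by (intro psubset_card_mono) auto
    then have "b \<bullet> z \<le> (\<Sum>v\<in>V. max 0 (b \<bullet> v))" by (rule less)
    moreover have "t \<bullet> v \<in> {-1, 0, 1}" if "v \<in> V" for v
      using bspec[OF t that] by (auto simp: sgn_if split: if_splits)
    then have "t \<bullet> z \<le> (\<Sum>v\<in>V. max 0 (t \<bullet> v))" by (intro elem ballI)
    then have "c * (t \<bullet> z) \<le> (\<Sum>v\<in>V. c * max 0 (t \<bullet> v))"
      unfolding sum_distrib_left[symmetric] by (intro mult_left_mono) (auto simp: c_def)
    moreover have "(\<Sum>v\<in>V. max 0 (a \<bullet> v)) = (\<Sum>v\<in>V. c * max 0 (t \<bullet> v)) + (\<Sum>v\<in>V. max 0 (b \<bullet> v))"
      using conf by (simp add: sum.distrib)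
    moreover have "a \<bullet> z = c * (t \<bullet> z) + b \<bullet> z"
      by (simp add: b_def inner_diff_left)
    ultimately show ?thesis by linarith
  qed (simp add: sum_nonneg)
qed

lemma finite_integral_functionals:
  assumes fin: "finite V" and sp: "span V = UNIV"
  shows "finite {k. \<forall>v\<in>V. k \<bullet> v \<in> \<int> \<and> \<bar>k \<bullet> v\<bar> \<le> B}"
proof (rule finite_imageD)
  let ?f = "\<lambda>k. restrict (\<lambda>v. k \<bullet> v) V"
  have "?f ` {k. \<forall>v\<in>V. k \<bullet> v \<in> \<int> \<and> \<bar>k \<bullet> v\<bar> \<le> B} \<subseteq> PiE V (\<lambda>_. {x \<in> \<int>. \<bar>x\<bar> \<le> B})"
    by auto
  then show "finite (?f ` {k. \<forall>v\<in>V. k \<bullet> v \<in> \<int> \<and> \<bar>k \<bullet> v\<bar> \<le> B})"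
    by (rule finite_subset) (intro finite_PiE fin finite_abs_int_segment)
  show "inj_on ?f {k. \<forall>v\<in>V. k \<bullet> v \<in> \<int> \<and> \<bar>k \<bullet> v\<bar> \<le> B}"
  proof (rule inj_onI)
    fix k l assume "?f k = ?f l"
    then have "\<And>v. v \<in> V \<Longrightarrow> (k - l) \<bullet> v = 0"
      by (metis inner_diff_left restrict_apply' right_minus_eq)
    then show "k = l" using inner_spanning_eq_0[OF sp, of "k - l"] by simp
  qed
qed

text \<open>
  Functionals that are integral on \<open>V\<close> form a lattice: only finitely many of them have values in a
  given bounded range, and outside a bounded range the distance to \<open>c\<close> exceeds the one attained by 0.
\<close>

lemma nearest_integral_functional:
  fixes V :: "'a::euclidean_space set" and c :: "'a \<Rightarrow> real"
  assumes fin: "finite V" and sp: "span V = UNIV"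
  obtains k where "\<forall>v\<in>V. k \<bullet> v \<in> \<int>"
    and "\<And>l. \<forall>v\<in>V. l \<bullet> v \<in> \<int> \<Longrightarrow> (\<Sum>v\<in>V. (c v - k \<bullet> v)\<^sup>2) \<le> (\<Sum>v\<in>V. (c v - l \<bullet> v)\<^sup>2)"
proof -
  define psi where "psi k = (\<Sum>v\<in>V. (c v - k \<bullet> v)\<^sup>2)" for k
  define K where "K = {k. (\<forall>v\<in>V. k \<bullet> v \<in> \<int>) \<and> psi k \<le> psi 0}"
  define B where "B = sqrt (psi 0) + (\<Sum>v\<in>V. \<bar>c v\<bar>)"
  have "\<bar>k \<bullet> v\<bar> \<le> B" if k: "k \<in> K" and v: "v \<in> V" for k v
  proof -
    have "(c v - k \<bullet> v)\<^sup>2 \<le> psi k"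
      unfolding psi_def using fin v by (intro member_le_sum) auto
    also have "\<dots> \<le> psi 0" using k by (simp add: K_def)
    finally have "\<bar>c v - k \<bullet> v\<bar> \<le> sqrt (psi 0)" by (rule real_le_rsqrt[of "\<bar>_\<bar>", simplified])
    moreover have "\<bar>c v\<bar> \<le> (\<Sum>v\<in>V. \<bar>c v\<bar>)"
      using fin v by (intro member_le_sum) auto
    ultimately show ?thesis unfolding B_def by linarith
  qed
  then have "K \<subseteq> {k. \<forall>v\<in>V. k \<bullet> v \<in> \<int> \<and> \<bar>k \<bullet> v\<bar> \<le> B}"
    by (auto simp: K_def)
  then have "finite K" using finite_integral_functionals[OF fin sp] finite_subset by blast
  moreover have "0 \<in> K" by (simp add: K_def)
  ultimately obtain k where k: "k \<in> K" and kmin: "\<And>l. l \<in> K \<Longrightarrow> psi k \<le> psi l"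
    using arg_min_if_finite(1)[of K psi] arg_min_least[of K _ psi] by blast
  show thesis
  proof (rule that)
    show "\<forall>v\<in>V. k \<bullet> v \<in> \<int>" using k by (simp add: K_def)
    fix l assume "\<forall>v\<in>V. l \<bullet> v \<in> \<int>"
    then have "psi k \<le> psi l" 
      using kmin[of l] k by (cases "l \<in> K") (auto simp: K_def)
    then show "(\<Sum>v\<in>V. (c v - k \<bullet> v)\<^sup>2) \<le> (\<Sum>v\<in>V. (c v - l \<bullet> v)\<^sup>2)"
      by (simp add: psi_def)
  qed
qed

text \<open>
  Let \<open>L\<close> be the lattice of value vectors \<open>(k \<bullet> v)\<^sub>v\<close> of functionals that are integral on \<open>V\<close>. The zonotope is,
  up to translation, the image of the Voronoi cell of \<open>L\<close>, and Voronoi cells tile.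
  For the covering, write a point with coefficients \<open>c\<close> and move it by a lattice vector nearest to
  \<open>c - 1/2\<close> (the shift centres the unit cube of coefficients). Minimality yields the elementary
  inequalities, and these suffice. For disjointness, the difference of two translation vectors has
  \<open>a\<close>-value \<open>\<Sum>(a \<bullet> v)\<^sup>2\<close>, which by integrality is at least \<open>\<Sum>\<bar>a \<bullet> v\<bar>\<close>, the width of the zonotope in
  direction \<open>a\<close>.
\<close>

theorem regular_zonotope_tiles:
  fixes V :: "'a::euclidean_space set"
  assumes reg: "regular_vectors V"
  shows "tiles_by_translates (minkowski_zonotope V)
    {\<Sum>v\<in>V. (k \<bullet> v) *\<^sub>R v | k. \<forall>v\<in>V. k \<bullet> v \<in> \<int>}" (is "tiles_by_translates ?Z ?T")
  unfolding tiles_by_translates_def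
proof (intro conjI ballI impI)
  have fin: "finite V" and sp: "span V = UNIV"
    using reg by (auto simp: regular_vectors_def)
  have "y \<in> (\<Union>t\<in>?T. (+) t ` ?Z)" for y
  proof -
    have "y \<in> span V" by (simp add: sp)
    then obtain c where y: "y = (\<Sum>v\<in>V. c v *\<^sub>R v)"
      by (auto simp: span_finite fin)
    obtain k where k: "\<forall>v\<in>V. k \<bullet> v \<in> \<int>"
      and near: "\<And>l. \<forall>v\<in>V. l \<bullet> v \<in> \<int> \<Longrightarrow>
        (\<Sum>v\<in>V. (c v - 1/2 - k \<bullet> v)\<^sup>2) \<le> (\<Sum>v\<in>V. (c v - 1/2 - l \<bullet> v)\<^sup>2)"
      using nearest_integral_functional[OF fin sp, of "\<lambda>v. c v - 1/2"] by blast
    define d where "d v = c v - 1/2 - k \<bullet> v" for v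
    define z where "z = y - (\<Sum>v\<in>V. (k \<bullet> v) *\<^sub>R v)"
    have z: "z = (\<Sum>v\<in>V. (d v + 1/2) *\<^sub>R v)"
      by (simp add: z_def y d_def scaleR_diff_left sum_subtractf)
    \<comment> \<open>Compare the nearest point with its neighbour in direction \<open>t\<close>; each entry \<open>s\<close> of \<open>t\<close> satisfies \<open>s\<^sup>2 = 2 * max 0 s - s\<close>.\<close>
    have elem: "t \<bullet> z \<le> (\<Sum>v\<in>V. max 0 (t \<bullet> v))" if t: "\<forall>v\<in>V. t \<bullet> v \<in> {-1, 0, 1}" for t
    proof -
      have "\<forall>v\<in>V. (k + t) \<bullet> v \<in> \<int>"
        using k t by (fastforce simp: inner_add_left)
      from near[OF this] have "0 \<le> (\<Sum>v\<in>V. (d v - t \<bullet> v)\<^sup>2 - (d v)\<^sup>2)"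
        by (simp add: d_def inner_add_left sum_subtractf algebra_simps)
      also have "\<dots> = (\<Sum>v\<in>V. 2 * max 0 (t \<bullet> v) - 2 * ((d v + 1/2) * (t \<bullet> v)))"
        using t by (intro sum.cong) (auto simp: power2_eq_square algebra_simps)
      also have "\<dots> = 2 * ((\<Sum>v\<in>V. max 0 (t \<bullet> v)) - t \<bullet> z)"
        by (simp add: z inner_sum_right sum_subtractf sum_distrib_left right_diff_distrib)
      finally show ?thesis by simp
    qed
    have "z \<in> ?Z"
    proof (rule ccontr)
      assume "z \<notin> ?Z"
      then obtain a b where ab: "a \<bullet> z < b" "\<forall>x\<in>?Z. b < a \<bullet> x"
        using separating_hyperplane_closed_point[of ?Z z] polytope_minkowski_zonotope[OF fin]
        by (meson polytope_imp_closed polytope_imp_convex)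
      \<comment> \<open>A separating functional would violate the inequality at a point of the face it exposes.\<close>
      obtain x where "x \<in> zonotope_face V (-a)"
        using zonotope_face_nonempty[OF fin] by blast
      then have "x \<in> ?Z" "(-a) \<bullet> x = (\<Sum>v\<in>V. max 0 ((-a) \<bullet> v))"
        by (auto simp: zonotope_face_def)
      then show False
        using elementary_inequalities_suffice[OF reg elem, of "-a"] ab by fastforce
    qed
    then show ?thesis
      using k by (intro UN_I[of "\<Sum>v\<in>V. (k \<bullet> v) *\<^sub>R v"]) (auto simp: z_def image_iff intro!: bexI[of _ z])
  qed
  then show "(\<Union>t\<in>?T. (+) t ` ?Z) = UNIV" by blast
next
  have fin: "finite V" and sp: "span V = UNIV"
    using reg by (auto simp: regular_vectors_def)
  have below: "a \<bullet> x < a \<bullet> s + (\<Sum>v\<in>V. max 0 (a \<bullet> v))"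
    if "a \<noteq> 0" "x \<in> interior ((+) s ` ?Z)" for a x s :: 'a
  proof -
    have "(+) s ` ?Z \<subseteq> {x. a \<bullet> x \<le> a \<bullet> s + (\<Sum>v\<in>V. max 0 (a \<bullet> v))}"
      using inner_le_zonotope_support[OF fin] by (auto simp: inner_add_right)
    then have "interior ((+) s ` ?Z) \<subseteq> {x. a \<bullet> x < a \<bullet> s + (\<Sum>v\<in>V. max 0 (a \<bullet> v))}"
      using interior_mono[of "(+) s ` ?Z"] interior_halfspace_le[OF that(1)] by blast
    then show ?thesis using that by blast
  qed
  fix s t assume "s \<in> ?T" "t \<in> ?T" "s \<noteq> t"
  then obtain k l where s: "s = (\<Sum>v\<in>V. (k \<bullet> v) *\<^sub>R v)" and t: "t = (\<Sum>v\<in>V. (l \<bullet> v) *\<^sub>R v)"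
    and k: "\<forall>v\<in>V. k \<bullet> v \<in> \<int>" and l: "\<forall>v\<in>V. l \<bullet> v \<in> \<int>" by blast
  define a where "a = k - l"
  have "a \<noteq> 0" using \<open>s \<noteq> t\<close> by (auto simp: a_def s t)
  have "s - t = (\<Sum>v\<in>V. (a \<bullet> v) *\<^sub>R v)"
    by (simp add: s t a_def inner_diff_left scaleR_diff_left sum_subtractf)
  then have "a \<bullet> (s - t) = (\<Sum>v\<in>V. (a \<bullet> v)\<^sup>2)"
    by (simp add: inner_sum_right power2_eq_square)
  moreover have "(\<Sum>v\<in>V. \<bar>a \<bullet> v\<bar>) \<le> (\<Sum>v\<in>V. (a \<bullet> v)\<^sup>2)"
  proof (rule sum_mono)
    fix v assume "v \<in> V"
    then have "a \<bullet> v \<in> \<int>" using k l by (auto simp: a_def inner_diff_left)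
    then obtain n where "a \<bullet> v = of_int n" by (rule Ints_cases)
    moreover have "\<bar>n\<bar> \<le> n\<^sup>2"
      using mult_left_mono[of 1 "\<bar>n\<bar>" "\<bar>n\<bar>"] by (cases "n = 0") (auto simp: power2_eq_square)
    ultimately show "\<bar>a \<bullet> v\<bar> \<le> (a \<bullet> v)\<^sup>2"
      by (metis of_int_abs of_int_le_iff of_int_power)
  qed
  moreover have "(\<Sum>v\<in>V. max 0 (a \<bullet> v)) + (\<Sum>v\<in>V. max 0 (- (a \<bullet> v))) = (\<Sum>v\<in>V. \<bar>a \<bullet> v\<bar>)"
    unfolding sum.distrib[symmetric] by (intro sum.cong) auto
  ultimately have "(\<Sum>v\<in>V. max 0 (a \<bullet> v)) + (\<Sum>v\<in>V. max 0 (- (a \<bullet> v))) \<le> a \<bullet> s - a \<bullet> t"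
    by (simp add: inner_diff_right)
  then show "interior ((+) s ` ?Z) \<inter> interior ((+) t ` ?Z) = {}"
    using below[of "-a" _ s] below[of a _ t] \<open>a \<noteq> 0\<close> by fastforce
qed

section \<open>Belts and normals of facets\<close>

definition share_belt :: "'a::euclidean_space set \<Rightarrow> 'a set \<Rightarrow> 'a set \<Rightarrow> bool" where
  "share_belt P F G \<longleftrightarrow> (\<exists>B\<in>belts P. F \<in> B \<and> G \<in> B)"

lemma span_zero_inner_eq_hyperplane:
  fixes V :: "'a::euclidean_space set"
  assumes "a \<noteq> 0" "DIM('a) \<le> dim {v \<in> V. a \<bullet> v = 0} + 1"
  shows "span {v \<in> V. a \<bullet> v = 0} = {x. a \<bullet> x = 0}"
proof (rule subspace_dim_equal)
  show "span {v \<in> V. a \<bullet> v = 0} \<subseteq> {x. a \<bullet> x = 0}"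
    by (rule span_minimal) (auto simp: subspace_hyperplane)
  show "dim {x. a \<bullet> x = 0} \<le> dim (span {v \<in> V. a \<bullet> v = 0})"
    using assms by (simp add: dim_hyperplane)
qed (auto simp: subspace_hyperplane)

text \<open>
  The functional exposing a facet is orthogonal to generators spanning a hyperplane, so this
  hyperplane is the direction space of the facet.
\<close>

lemma facet_hyperplane:
  fixes V :: "'a::euclidean_space set"
  assumes fin: "finite V" and sp: "span V = UNIV" and F: "F facet_of minkowski_zonotope V"
  obtains a where "a \<noteq> 0" "dim {v \<in> V. a \<bullet> v = 0} + 1 = DIM('a)"
    "direction_space F = {x. a \<bullet> x = 0}"
proof -
  obtain a where a: "F = zonotope_face V a"
    using F face_of_minkowski_zonotope_iff[OF fin] by (auto simp: facet_of_def)
  have "dim V = DIM('a)" using sp by (simp add: dim_eq_full)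
  then have d: "dim {v \<in> V. a \<bullet> v = 0} + 1 = DIM('a)"
    using F fin by (simp add: facet_of_def a aff_dim_zonotope_face aff_dim_minkowski_zonotope)
  then have "a \<noteq> 0" using \<open>dim V = _\<close> by auto
  with d show thesis
    using fin by (intro that[of a]) (simp_all add: a direction_space_zonotope_face span_zero_inner_eq_hyperplane)
qed

lemma zonotope_facetI:
  fixes V :: "'a::euclidean_space set"
  assumes fin: "finite V" and sp: "span V = UNIV"
    and a: "a \<noteq> 0" "DIM('a) \<le> dim {v \<in> V. a \<bullet> v = 0} + 1"
  obtains F where "F facet_of minkowski_zonotope V" "direction_space F = {x. a \<bullet> x = 0}"
proof
  have "dim V = DIM('a)" using sp by (simp add: dim_eq_full)
  moreover have "dim (span {v \<in> V. a \<bullet> v = 0}) = DIM('a) - 1"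
    by (subst span_zero_inner_eq_hyperplane[OF a]) (rule dim_hyperplane[OF a(1)])
  then have "dim {v \<in> V. a \<bullet> v = 0} + 1 = DIM('a)"
    by (simp add: Suc_leI)
  ultimately show "zonotope_face V a facet_of minkowski_zonotope V"
    using face_of_minkowski_zonotope_iff[OF fin] fin
    by (auto simp: facet_of_def aff_dim_zonotope_face aff_dim_minkowski_zonotope)
  show "direction_space (zonotope_face V a) = {x. a \<bullet> x = 0}"
    using fin a by (simp add: direction_space_zonotope_face span_zero_inner_eq_hyperplane)
qed

text \<open>
  The ridge defining the belt is parallel to both facets, and its direction space is spanned by
  generators; these must be orthogonal to both normals.
\<close>

lemma share_belt_dim:
  fixes V :: "'a::euclidean_space set"
  assumes fin: "finite V" and sp: "span V = UNIV"
    and belt: "share_belt (minkowski_zonotope V) F G"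
    and a: "direction_space F = {x. a \<bullet> x = 0}" and b: "direction_space G = {x. b \<bullet> x = 0}"
  shows "DIM('a) \<le> dim {v \<in> V. a \<bullet> v = 0 \<and> b \<bullet> v = 0} + 2"
proof -
  obtain R where R: "R ridge_of minkowski_zonotope V"
    and sub: "direction_space R \<subseteq> direction_space F" "direction_space R \<subseteq> direction_space G"
    using belt by (auto simp: share_belt_def belts_def belt_def)
  obtain r where r: "R = zonotope_face V r"
    using R face_of_minkowski_zonotope_iff[OF fin] by (auto simp: ridge_of_def)
  have "dim V = DIM('a)" using sp by (simp add: dim_eq_full)
  then have "dim {v \<in> V. r \<bullet> v = 0} + 2 = DIM('a)"
    using R fin by (simp add: ridge_of_def r aff_dim_zonotope_face aff_dim_minkowski_zonotope)
  moreover have "{v \<in> V. r \<bullet> v = 0} \<subseteq> {v \<in> V. a \<bullet> v = 0 \<and> b \<bullet> v = 0}"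
    using sub span_superset[of "{v \<in> V. r \<bullet> v = 0}"]
    unfolding r direction_space_zonotope_face[OF fin] a b by blast
  then have "dim {v \<in> V. r \<bullet> v = 0} \<le> dim {v \<in> V. a \<bullet> v = 0 \<and> b \<bullet> v = 0}"
    by (rule dim_subset)
  ultimately show ?thesis by linarith
qed

text \<open>
  Any ridge contained in one of two parallel facets defines a belt containing both.
\<close>

lemma share_belt_if_parallel:
  fixes V :: "'a::euclidean_space set"
  assumes fin: "finite V" and sp: "span V = UNIV" and dim: "2 \<le> DIM('a)"
    and F: "F facet_of minkowski_zonotope V" and G: "G facet_of minkowski_zonotope V"
    and FG: "direction_space F = direction_space G"
  shows "share_belt (minkowski_zonotope V) F G"
proof -
  let ?Z = "minkowski_zonotope V"
  have "dim V = DIM('a)" using sp by (simp add: dim_eq_full)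
  then have "aff_dim ?Z = DIM('a)" using fin by (simp add: aff_dim_minkowski_zonotope)
  then have "0 < aff_dim F" using F dim by (simp add: facet_of_def)
  moreover have "polytope F"
    using F polytope_minkowski_zonotope[OF fin] by (meson face_of_polytope_polytope facet_of_imp_face_of)
  ultimately obtain R where R: "R facet_of F" by (meson polytope_facet_exists)
  then have "R ridge_of ?Z"
    using F by (auto simp: ridge_of_def facet_of_def intro: face_of_trans)
  moreover have "direction_space R \<subseteq> direction_space F"
    using hull_mono[OF facet_of_imp_subset[OF R], of affine] by (auto simp: direction_space_def)
  ultimately show ?thesis
    using F G FG by (auto simp: share_belt_def belts_def belt_def)
qed

text \<open>
  Converse of the dimension bound for two facets in a belt. If the normals \<open>a\<close> and \<open>b\<close> are independent,
  a generic combination \<open>a + e b\<close> is orthogonal to exactly those generators that are orthogonal to both,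
  so it exposes a ridge parallel to both facets. Otherwise the facets are parallel.
\<close>

lemma share_beltI:
  fixes V :: "'a::euclidean_space set"
  assumes fin: "finite V" and sp: "span V = UNIV" and dim: "2 \<le> DIM('a)"
    and F: "F facet_of minkowski_zonotope V" and G: "G facet_of minkowski_zonotope V"
    and a: "direction_space F = {x. a \<bullet> x = 0}" "a \<noteq> 0"
    and b: "direction_space G = {x. b \<bullet> x = 0}" "b \<noteq> 0"
    and d: "DIM('a) \<le> dim {v \<in> V. a \<bullet> v = 0 \<and> b \<bullet> v = 0} + 2"
  shows "share_belt (minkowski_zonotope V) F G"
proof (cases "dim {v \<in> V. a \<bullet> v = 0 \<and> b \<bullet> v = 0} + 2 = DIM('a)")
  case True
  let ?Z = "minkowski_zonotope V" and ?S = "{v \<in> V. a \<bullet> v = 0 \<and> b \<bullet> v = 0}"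
  obtain e where e: "e \<notin> (\<lambda>v. - (a \<bullet> v) / (b \<bullet> v)) ` V"
    using ex_new_if_finite[of "(\<lambda>v. - (a \<bullet> v) / (b \<bullet> v)) ` V"] fin infinite_UNIV_char_0 by blast
  define r where "r = a + e *\<^sub>R b"
  have "e = - (a \<bullet> v) / (b \<bullet> v)" if "r \<bullet> v = 0" "b \<bullet> v \<noteq> 0" for v
    using that by (simp add: r_def inner_add_left field_simps)
  then have S: "{v \<in> V. r \<bullet> v = 0} = ?S"
    using e by (force simp: r_def inner_add_left)
  have "dim V = DIM('a)" using sp by (simp add: dim_eq_full)
  then have "zonotope_face V r ridge_of ?Z"
    using face_of_minkowski_zonotope_iff[OF fin] fin True
    by (auto simp: ridge_of_def aff_dim_zonotope_face aff_dim_minkowski_zonotope S)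
  moreover have "span ?S \<subseteq> {x. a \<bullet> x = 0}" "span ?S \<subseteq> {x. b \<bullet> x = 0}"
    by (rule span_minimal; auto simp: subspace_hyperplane)+
  then have "direction_space (zonotope_face V r) \<subseteq> direction_space F"
    "direction_space (zonotope_face V r) \<subseteq> direction_space G"
    using fin by (auto simp: direction_space_zonotope_face S a b)
  ultimately show ?thesis
    using F G by (auto simp: share_belt_def belts_def belt_def)
next
  case False
  let ?S = "{v \<in> V. a \<bullet> v = 0 \<and> b \<bullet> v = 0}"
  have "span ?S = {x. c \<bullet> x = 0}" if c: "c = a \<or> c = b" for c
  proof (rule subspace_dim_equal)
    show "span ?S \<subseteq> {x. c \<bullet> x = 0}"
      using c by (intro span_minimal) (auto simp: subspace_hyperplane)
    have "c \<noteq> 0" using a b c by blast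
    then show "dim {x. c \<bullet> x = 0} \<le> dim (span ?S)"
      using d False by (simp add: dim_hyperplane)
  qed (auto simp: subspace_hyperplane)
  from this[of a] this[of b] have "{x. a \<bullet> x = 0} = {x. b \<bullet> x = 0}" by simp
  then show ?thesis
    using share_belt_if_parallel[OF fin sp dim F G] a b by simp
qed

lemma belt_distance_le_3:
  assumes "share_belt P F M" "share_belt P M N" "share_belt P N G"
  shows "belt_distance P F G \<le> 3"
proof -
  obtain B1 B2 B3 where B: "B1 \<in> belts P" "B2 \<in> belts P" "B3 \<in> belts P"
    "F \<in> B1" "M \<in> B1" "M \<in> B2" "N \<in> B2" "N \<in> B3" "G \<in> B3"
    using assms unfolding share_belt_def by blast
  have "H facet_of P" if "B \<in> belts P" "H \<in> B" for H B
    using that by (auto simp: belts_def belt_def)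
  moreover define \<F> where "\<F> i = (if i = 0 then F else if i = 1 then M else if i = 2 then N else G)" for i :: nat
  moreover define \<B> where "\<B> i = (if i = 1 then B1 else if i = 2 then B2 else B3)" for i :: nat
  moreover have "i \<in> {1..3} \<longleftrightarrow> i = 1 \<or> i = 2 \<or> i = 3" for i :: nat by auto
  ultimately have "belt_path P 3 \<F> \<B>"
    using B by (auto simp: belt_path_def)
  moreover have "\<F> 0 = F" "\<F> 3 = G" by (simp_all add: \<F>_def)
  ultimately have "enat 3 \<in> {enat n | n. \<exists>\<F> \<B>. belt_path P n \<F> \<B> \<and> \<F> 0 = F \<and> \<F> n = G}"
    by blast
  then have "Inf {enat n | n. \<exists>\<F> \<B>. belt_path P n \<F> \<B> \<and> \<F> 0 = F \<and> \<F> n = G} \<le> enat 3"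
    by (rule Inf_lower)
  then show ?thesis
    by (simp add: belt_distance_def numeral_eq_enat)
qed

text \<open>
  Paths of length less than 2 are excluded along with those of length 2: a path of length
  1 or 0 has the middle facet \<open>M = G\<close>.
\<close>

lemma belt_distance_ge_3:
  assumes not_opp: "\<not> opposite_facets P F G"
    and refl: "share_belt P G G"
    and no_mid: "\<And>M. share_belt P F M \<Longrightarrow> share_belt P M G \<Longrightarrow> False"
  shows "3 \<le> belt_distance P F G"
proof -
  have long: "3 \<le> n" if path: "belt_path P n \<F> \<B>" and ends: "\<F> 0 = F" "\<F> n = G" for n \<F> \<B>
  proof (rule ccontr)
    assume "\<not> 3 \<le> n"
    have step: "share_belt P (\<F> (i - 1)) (\<F> i)" if "i \<in> {1..n}" for i
      using path that unfolding belt_path_def share_belt_def by blast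
    consider "n = 0" | "n = 1" | "n = 2" using \<open>\<not> 3 \<le> n\<close> by linarith
    then show False
    proof cases
      case 1
      then show False using ends refl no_mid[of G] by simp
    next
      case 2
      then show False using ends refl no_mid[of G] step[of 1] by simp
    next
      case 3
      then show False using ends no_mid[of "\<F> 1"] step[of 1] step[of 2] by simp
    qed
  qed
  have "enat 3 \<le> Inf {enat n | n. \<exists>\<F> \<B>. belt_path P n \<F> \<B> \<and> \<F> 0 = F \<and> \<F> n = G}"
  proof (intro Inf_greatest)
    fix x assume "x \<in> {enat n | n. \<exists>\<F> \<B>. belt_path P n \<F> \<B> \<and> \<F> 0 = F \<and> \<F> n = G}"
    then obtain n \<F> \<B> where "x = enat n" "belt_path P n \<F> \<B>" "\<F> 0 = F" "\<F> n = G" by blast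
    then show "enat 3 \<le> x" using long by simp
  qed
  then show ?thesis
    using not_opp by (simp only: belt_distance_def numeral_eq_enat if_False)
qed

lemma opposite_facets_direction_space:
  assumes "opposite_facets P F G"
  shows "direction_space G = direction_space F"
proof -
  obtain c where "G = (\<lambda>x. 2 *\<^sub>R c - x) ` F"
    using assms by (auto simp: opposite_facets_def)
  then have "G = (+) (2 *\<^sub>R c) ` (uminus ` F)"
    by (simp add: image_image)
  moreover have "affine hull (uminus ` F) = uminus ` (affine hull F)"
    by (rule affine_hull_linear_image[symmetric]) (rule bounded_linear_minus[OF bounded_linear_ident])
  ultimately have "affine hull G = (+) (2 *\<^sub>R c) ` (uminus ` (affine hull F))"
    by (simp only: affine_hull_translation)
  then have "affine hull G = (\<lambda>x. 2 *\<^sub>R c - x) ` (affine hull F)"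
    by (simp add: image_image)
  then have G: "x \<in> affine hull G \<longleftrightarrow> 2 *\<^sub>R c - x \<in> affine hull F" for x
    by (auto simp: image_iff intro!: bexI[of _ "2 *\<^sub>R c - x"])
  show ?thesis
  proof (intro equalityI subsetI)
    fix z assume "z \<in> direction_space G"
    then obtain x y where "z = x - y" "x \<in> affine hull G" "y \<in> affine hull G"
      by (auto simp: direction_space_def)
    then show "z \<in> direction_space F"
      unfolding direction_space_def G
      by (intro CollectI exI[of _ "2 *\<^sub>R c - y"] exI[of _ "2 *\<^sub>R c - x"]) auto
  next
    fix z assume "z \<in> direction_space F"
    then obtain x y where "z = x - y" "x \<in> affine hull F" "y \<in> affine hull F"
      by (auto simp: direction_space_def)
    then show "z \<in> direction_space G"
      unfolding direction_space_def G
      by (intro CollectI exI[of _ "2 *\<^sub>R c - y"] exI[of _ "2 *\<^sub>R c - x"]) auto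
  qed
qed

section \<open>Circulations and directed cycles\<close>

definition circulation :: "('v::finite \<Rightarrow> 'v \<Rightarrow> real) \<Rightarrow> bool" where
  "circulation f \<longleftrightarrow> (\<forall>i j. f j i = - f i j) \<and> (\<forall>i. (\<Sum>j\<in>UNIV. f i j) = 0)"

definition cycle_edges :: "'v list \<Rightarrow> ('v \<times> 'v) list" where
  "cycle_edges xs = zip xs (rotate1 xs)"

text \<open>
  Summing over the list of edges, rather than testing membership, makes conservation hold for every
  closed walk.
\<close>

definition cycle_flow :: "'v list \<Rightarrow> 'v \<Rightarrow> 'v \<Rightarrow> real" where
  "cycle_flow xs i j = (\<Sum>e\<leftarrow>cycle_edges xs. of_bool (e = (i, j)) - of_bool (e = (j, i)))"

text \<open>
  At each vertex the walk leaves as often as it arrives, because the first and the second components of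
  its edges list the same vertices.
\<close>

lemma circulation_cycle_flow: "circulation (cycle_flow xs)"
  for xs :: "'v::finite list"
  unfolding circulation_def
proof (intro conjI allI)
  fix i j
  show "cycle_flow xs j i = - cycle_flow xs i j"
    unfolding cycle_flow_def uminus_sum_list_map by (simp add: comp_def)
next
  fix i
  have "(\<Sum>j\<in>UNIV. cycle_flow xs i j) =
      (\<Sum>e\<leftarrow>cycle_edges xs. \<Sum>j\<in>UNIV. of_bool (e = (i, j)) - of_bool (e = (j, i)))"
  proof -
    have "(\<Sum>j\<in>UNIV. \<Sum>e\<leftarrow>es. g j e) = (\<Sum>e\<leftarrow>es. \<Sum>j\<in>UNIV. g j e)"
      for es :: "('v \<times> 'v) list" and g :: "'v \<Rightarrow> 'v \<times> 'v \<Rightarrow> real"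
      by (induction es) (simp_all add: sum.distrib)
    then show ?thesis unfolding cycle_flow_def .
  qed
  also have "\<dots> = (\<Sum>e\<leftarrow>cycle_edges xs. of_bool (fst e = i) - of_bool (snd e = i))"
  proof -
    have "(\<Sum>j\<in>UNIV. of_bool (e = (i, j)) - of_bool (e = (j, i))) =
        (of_bool (fst e = i) - of_bool (snd e = i) :: real)" for e :: "'v \<times> 'v"
      by (cases e) (simp add: sum_subtractf of_bool_conj flip: sum_distrib_left sum_distrib_right)
    then show ?thesis by simp
  qed
  also have "\<dots> = (\<Sum>a\<leftarrow>map fst (cycle_edges xs). of_bool (a = i)) - (\<Sum>b\<leftarrow>map snd (cycle_edges xs). of_bool (b = i))"
    by (simp add: sum_list_subtractf comp_def)
  also have "map fst (cycle_edges xs) = xs"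
    by (simp add: cycle_edges_def)
  also have "map snd (cycle_edges xs) = rotate1 xs"
    by (simp add: cycle_edges_def)
  also have "(\<Sum>b\<leftarrow>rotate1 xs. of_bool (b = i)) = (\<Sum>b\<leftarrow>xs. of_bool (b = i) :: real)"
    by (cases xs) simp_all
  finally show "(\<Sum>j\<in>UNIV. cycle_flow xs i j) = 0" by simp
qed

lemma cycle_flow_distinct:
  assumes "distinct xs"
  shows "cycle_flow xs i j = of_bool ((i, j) \<in> set (cycle_edges xs)) - of_bool ((j, i) \<in> set (cycle_edges xs))"
proof -
  have count: "(\<Sum>e\<leftarrow>es. of_bool (e = p)) = (of_bool (p \<in> set es) :: real)" if "distinct es"
    for es and p :: "'a \<times> 'a"
    using that by (induction es) auto
  have "distinct (cycle_edges xs)"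
    using assms by (simp add: cycle_edges_def distinct_zipI1)
  then show ?thesis
    by (simp add: cycle_flow_def sum_list_subtractf count)
qed

text \<open>
  Conservation forces positive flow out of every vertex that receives positive flow, so one can follow
  the flow forever. The walk up to its first repetition of a vertex closes up to a simple cycle;
  antisymmetry excludes lengths 1 and 2.
\<close>

lemma circulation_contains_directed_cycle:
  fixes f :: "'v::finite \<Rightarrow> 'v \<Rightarrow> real"
  assumes f: "circulation f" and "f i j \<noteq> 0"
  obtains xs where "distinct xs" "3 \<le> length xs" "\<And>a b. (a, b) \<in> set (cycle_edges xs) \<Longrightarrow> 0 < f a b"
proof -
  have anti: "f b a = - f a b" for a b using f unfolding circulation_def by blast
  have step: "\<exists>c. 0 < f b c" if "0 < f a b" for a b
  proof (rule ccontr)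
    assume "\<not> ?thesis"
    then have le: "f b c \<le> 0" for c by (simp add: not_less)
    have lt: "f b a < 0" using that anti[of a b] by linarith
    have "(\<Sum>c\<in>UNIV. f b c) = 0"
      using f unfolding circulation_def by blast
    then have "(\<Sum>c\<in>UNIV. - f b c) = 0" by (simp add: sum_negf)
    then have "- f b a = 0"
      using le by (subst (asm) sum_nonneg_eq_0_iff) auto
    with lt show False by simp
  qed
  have "0 < f i j \<or> 0 < f j i"
    using assms(2) anti[of i j] by linarith
  then obtain a b where ab: "0 < f a b" by blast
  define next_vertex where "next_vertex b = (SOME c. 0 < f b c)" for b
  define s where "s n = (next_vertex ^^ n) b" for n
  have pos: "0 < f (s n) (s (Suc n))" for n
  proof (induction n)
    case 0
    show ?case using someI_ex[OF step[OF ab]] by (simp add: s_def next_vertex_def)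
  next
    case (Suc n)
    show ?case using someI_ex[OF step[OF Suc]] by (simp add: s_def next_vertex_def)
  qed
  have "\<not> inj s" using finite_imageD[of s UNIV] infinite_UNIV_nat by auto
  then obtain k l where "s k = s l" "k \<noteq> l" by (auto simp: inj_def)
  then have ex: "\<exists>n. \<exists>m<n. s m = s n" by (cases k l rule: linorder_cases) (auto, metis)
  define N where "N = (LEAST n. \<exists>m<n. s m = s n)"
  obtain m where m: "m < N" "s m = s N" using LeastI_ex[OF ex] unfolding N_def by blast
  have first: "s k \<noteq> s l" if "k < l" "l < N" for k l
    using not_less_Least[of l "\<lambda>n. \<exists>m<n. s m = s n"] that unfolding N_def by blast
  define xs where "xs = map s [m..<N]"
  have "rotate1 xs = map s [Suc m..<Suc N]"
    using m by (simp add: xs_def upt_conv_Cons)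
  moreover have "map s [Suc m..<Suc N] = map (\<lambda>k. s (Suc k)) [m..<N]"
    by (simp add: map_Suc_upt[symmetric] comp_def del: upt_Suc map_Suc_upt)
  ultimately have "cycle_edges xs = map (\<lambda>k. (s k, s (Suc k))) [m..<N]"
    by (simp add: cycle_edges_def xs_def zip_map_map zip_same_conv_map)
  then have edges: "\<exists>k. e = (s k, s (Suc k))" if "e \<in> set (cycle_edges xs)" for e
    using that by auto
  have "s k = s l \<Longrightarrow> k = l" if "k < N" "l < N" for k l
    using first[of k l] first[of l k] that by (cases k l rule: linorder_cases) simp_all
  then have "distinct xs" by (auto simp: xs_def distinct_map inj_on_def)
  moreover have "N \<noteq> Suc m"
  proof
    assume "N = Suc m"
    with pos[of m] m(2) have "0 < f (s m) (s m)" by simp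
    with anti[of "s m" "s m"] show False by linarith
  qed
  moreover have "N \<noteq> Suc (Suc m)"
  proof
    assume "N = Suc (Suc m)"
    with pos[of "Suc m"] m(2) have "0 < f (s (Suc m)) (s m)" by simp
    with pos[of m] anti[of "s m" "s (Suc m)"] show False by linarith
  qed
  then have "3 \<le> length xs" using m \<open>N \<noteq> Suc m\<close> by (simp add: xs_def)
  moreover have "0 < f a b" if "(a, b) \<in> set (cycle_edges xs)" for a b
    using edges[OF that] pos by blast
  ultimately show thesis using that by blast
qed

lemma cycle_flow_conformal:
  assumes f: "circulation f" and xs: "distinct xs"
    and pos: "\<And>a b. (a, b) \<in> set (cycle_edges xs) \<Longrightarrow> 0 < f a b"
  shows "cycle_flow xs i j = 0 \<or> cycle_flow xs i j = sgn (f i j)"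
proof -
  have "f j i = - f i j" using f unfolding circulation_def by blast
  then show ?thesis
    using pos[of i j] pos[of j i] by (auto simp: cycle_flow_distinct[OF xs] sgn_if)
qed

section \<open>The cographic matroid of a complete graph\<close>

text \<open>
  The vectors \<open>u i j\<close> represent the cographic matroid of the complete graph on \<open>'v\<close>: the points of \<open>'a\<close>
  correspond to the circulations \<open>f\<close> via \<open>f i j = x \<bullet> u i j\<close>. Consequently facet normals are cycles.
\<close>

locale cographic_representation =
  fixes u :: "'v::finite \<Rightarrow> 'v \<Rightarrow> 'a::euclidean_space"
  assumes u_antisym: "u j i = - u i j"
    and u_conserved: "(\<Sum>j\<in>UNIV. u i j) = 0"
    and u_spanning: "span (range (case_prod u)) = UNIV"
    and u_universal: "circulation f \<Longrightarrow> \<exists>x. \<forall>i j. x \<bullet> u i j = f i j"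
begin

text \<open>
  Both orientations of each edge are included, so an edge contributes a segment from \<open>-u i j\<close> to \<open>u i j\<close>.
  This avoids choosing an orientation of the graph and only scales the zonotope by 2 and translates it.
\<close>

abbreviation "V \<equiv> range (case_prod u)"

lemma circulation_inner: "circulation (\<lambda>i j. x \<bullet> u i j)"
  unfolding circulation_def
  by (metis (no_types, lifting) inner_minus_right inner_sum_right inner_zero_right sum.cong u_antisym u_conserved)

lemma eq_0_if_flow_0:
  assumes "\<And>i j. x \<bullet> u i j = 0"
  shows "x = 0"
  by (rule inner_spanning_eq_0[OF u_spanning]) (use assms in auto)

text \<open>
  The conformal cycle through the support of a nonzero circulation, transported to \<open>'a\<close>.
\<close>

lemma cycle_in_support:
  assumes "a \<noteq> 0"
  obtains xs t where "distinct xs" "3 \<le> length xs" "t \<noteq> 0"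
    "\<And>i j. t \<bullet> u i j = cycle_flow xs i j"
    "\<And>i j. t \<bullet> u i j = 0 \<or> t \<bullet> u i j = sgn (a \<bullet> u i j)"
proof -
  obtain i j where "a \<bullet> u i j \<noteq> 0" using eq_0_if_flow_0 assms by blast
  then obtain xs where xs: "distinct xs" "3 \<le> length xs"
    and pos: "\<And>b c. (b, c) \<in> set (cycle_edges xs) \<Longrightarrow> 0 < a \<bullet> u b c"
    using circulation_contains_directed_cycle[OF circulation_inner] by blast
  obtain t where t: "\<And>i j. t \<bullet> u i j = cycle_flow xs i j"
    using u_universal[OF circulation_cycle_flow] by blast
  have "length (cycle_edges xs) = length xs" by (simp add: cycle_edges_def)
  then have "cycle_edges xs \<noteq> []" using xs by auto
  then have "hd (cycle_edges xs) \<in> set (cycle_edges xs)" by simp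
  then obtain b c where bc: "(b, c) \<in> set (cycle_edges xs)" by (metis surj_pair)
  have "(c, b) \<notin> set (cycle_edges xs)"
    using pos[OF bc] pos[of c b] by (auto simp: u_antisym[of c b])
  then have "t \<bullet> u b c = 1" using t xs bc by (simp add: cycle_flow_distinct)
  then have "t \<noteq> 0" by auto
  moreover have "t \<bullet> u i j = 0 \<or> t \<bullet> u i j = sgn (a \<bullet> u i j)" for i j
    unfolding t using cycle_flow_conformal[OF circulation_inner xs(1) pos] .
  ultimately show thesis using that xs t by blast
qed

text \<open>
  Directed cycles inside the support of a circulation are the conformal elementary functionals.
\<close>

lemma edge_vectors_regular: "regular_vectors V"
  unfolding regular_vectors_def
proof (intro conjI allI impI)
  fix a :: 'a assume "a \<noteq> 0"
  then obtain t where "t \<noteq> 0" "\<And>i j. t \<bullet> u i j = 0 \<or> t \<bullet> u i j = sgn (a \<bullet> u i j)"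
    by (rule cycle_in_support) blast
  then show "\<exists>t. t \<noteq> 0 \<and> (\<forall>v\<in>V. t \<bullet> v = 0 \<or> t \<bullet> v = sgn (a \<bullet> v))"
    by (intro exI[of _ t]) auto
qed (simp_all add: u_spanning)

end

lemma card_strict_pairs:
  "2 * card {(i, j). i < (j :: 'n :: {finite, linorder})} = CARD('n) * (CARD('n) - 1)"
proof -
  let ?P = "{(i, j). i < (j :: 'n)}"
  have "(UNIV :: ('n \<times> 'n) set) = (range (\<lambda>i. (i, i)) \<union> ?P) \<union> prod.swap ` ?P"
    by (auto simp: image_iff)
  also have "card \<dots> = CARD('n) + card ?P + card ?P"
    by (subst card_Un_disjoint; (subst card_Un_disjoint)?) (auto simp: card_image inj_on_def)
  finally show ?thesis
    by (simp add: card_cartesian_product algebra_simps flip: UNIV_Times_UNIV)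
qed

text \<open>
  Removing the star of the vertex \<open>None\<close>, a spanning tree, leaves the edges between the remaining
  vertices, and a circulation is determined by arbitrary values on these. They are sent to an
  orthonormal basis, and Kirchhoff's law then dictates the vectors of the star.
\<close>

lemma cographic_representation_exists:
  assumes dim: "DIM('a) = card {(i, j). i < (j :: 'n)}"
  obtains u :: "'n::{finite, linorder} option \<Rightarrow> 'n option \<Rightarrow> 'a::euclidean_space"
  where "cographic_representation u"
proof -
  let ?P = "{(i, j). i < (j :: 'n)}"
  obtain h :: "'n \<times> 'n \<Rightarrow> 'a" where h: "bij_betw h ?P Basis"
    using finite_same_card_bij[of ?P "Basis :: 'a set"] dim by auto
  define b where "b i j = (if i < j then h (i, j) else if j < i then - h (j, i) else 0)" for i j
  define u where "u p q = (case (p, q) of (Some i, Some j) \<Rightarrow> b i j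
      | (None, Some i) \<Rightarrow> \<Sum>j\<in>UNIV. b i j | (Some i, None) \<Rightarrow> - (\<Sum>j\<in>UNIV. b i j) | (None, None) \<Rightarrow> 0)" for p q
  have b_anti: "b j i = - b i j" for i j by (auto simp: b_def)
  have sum_opt: "(\<Sum>p\<in>UNIV. g p) = g None + (\<Sum>i\<in>UNIV. g (Some i))" for g :: "'n option \<Rightarrow> 'b::comm_monoid_add"
    by (simp add: UNIV_option_conv sum.reindex)
  have "cographic_representation u"
  proof
    fix i j show "u j i = - u i j"
      by (auto simp: u_def split: option.split intro: b_anti)
  next
    fix p
    have "(\<Sum>i\<in>UNIV. \<Sum>j\<in>UNIV. b i j) = - (\<Sum>i\<in>UNIV. \<Sum>j\<in>UNIV. b i j)"
      by (subst sum.swap) (simp only: sum_negf[symmetric] b_anti[symmetric])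
    then have "2 *\<^sub>R (\<Sum>i\<in>UNIV. \<Sum>j\<in>UNIV. b i j) = 0"
      unfolding scaleR_2 by (simp only: eq_neg_iff_add_eq_0)
    then have "(\<Sum>i\<in>UNIV. \<Sum>j\<in>UNIV. b i j) = 0" by simp
    then show "(\<Sum>q\<in>UNIV. u p q) = 0"
      by (cases p) (simp_all add: sum_opt u_def)
  next
    have "Basis \<subseteq> range (case_prod u)"
    proof
      fix e :: 'a assume "e \<in> Basis"
      then have "e \<in> h ` ?P" using h by (simp add: bij_betw_def)
      then obtain i j where "i < j" "e = h (i, j)" by blast
      then have "e = case_prod u (Some i, Some j)" by (simp add: u_def b_def)
      then show "e \<in> range (case_prod u)" by blast
    qed
    then show "span (range (case_prod u)) = UNIV"
      by (metis span_Basis span_mono top.extremum_uniqueI)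
  next
    fix f :: "'n option \<Rightarrow> 'n option \<Rightarrow> real" assume f: "circulation f"
    have anti: "f q p = - f p q" for p q using f unfolding circulation_def by blast
    define x where "x = (\<Sum>(i, j)\<in>?P. f (Some i) (Some j) *\<^sub>R h (i, j))"
    have xh: "x \<bullet> h (i, j) = f (Some i) (Some j)" if "i < j" for i j
    proof -
      have "h p \<bullet> h (i, j) = of_bool (p = (i, j))" if "p \<in> ?P" for p
      proof -
        have q: "(i, j) \<in> ?P" using \<open>i < j\<close> by simp
        have "h p \<in> Basis" "h (i, j) \<in> Basis"
          using bij_betwE[OF h] \<open>p \<in> ?P\<close> q by blast+
        moreover have "h p = h (i, j) \<longleftrightarrow> p = (i, j)"
          using bij_betw_imp_inj_on[OF h] \<open>p \<in> ?P\<close> q by (rule inj_on_eq_iff)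
        ultimately show ?thesis by (simp add: inner_Basis)
      qed
      then have "x \<bullet> h (i, j) = (\<Sum>p\<in>?P. if p = (i, j) then f (Some i) (Some j) else 0)"
        unfolding x_def inner_sum_left by (intro sum.cong) auto
      then show ?thesis using that by simp
    qed
    have diag: "f p p = 0" for p using anti[of p p] by linarith
    have xb: "x \<bullet> b i j = f (Some i) (Some j)" for i j
    proof (cases i j rule: linorder_cases)
      case equal
      then show ?thesis using diag[of "Some i"] by (simp add: b_def)
    next
      case greater
      then have "\<not> i < j" by simp
      with greater show ?thesis
        using xh[of j i] anti[of "Some i" "Some j"] by (simp add: b_def)
    qed (simp add: b_def xh)
    have row: "(\<Sum>j\<in>UNIV. f (Some i) (Some j)) = - f (Some i) None" for i
    proof -
      have "(\<Sum>q\<in>UNIV. f (Some i) q) = 0" using f unfolding circulation_def by blast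
      then show ?thesis by (simp add: sum_opt)
    qed
    have "x \<bullet> u p q = f p q" for p q
      using anti[of None q]
      by (cases p; cases q) (simp_all add: u_def inner_sum_right xb row diag)
    then show "\<exists>x. \<forall>p q. x \<bullet> u p q = f p q" by blast
  qed
  then show thesis by (rule that)
qed

text \<open>
  Used to bound dimensions of spans of edge vectors from below: no nonzero circulation may vanish on
  the edges of \<open>S\<close> and on the few extra edges \<open>W\<close>.
\<close>

lemma DIM_le_dim_add_card:
  fixes S W :: "'a::euclidean_space set"
  assumes fin: "finite W"
    and trivial: "\<And>x. (\<And>v. v \<in> S \<Longrightarrow> x \<bullet> v = 0) \<Longrightarrow> (\<And>w. w \<in> W \<Longrightarrow> x \<bullet> w = 0) \<Longrightarrow> x = 0"
  shows "DIM('a) \<le> dim S + card W"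
proof -
  obtain B where B: "B \<subseteq> S" "S \<subseteq> span B" "card B = dim S" "independent B"
    using basis_exists by metis
  have "span (B \<union> W) = UNIV"
  proof (rule ccontr)
    assume "span (B \<union> W) \<noteq> UNIV"
    then obtain x where x: "x \<noteq> 0" and orth: "\<And>y. y \<in> span (B \<union> W) \<Longrightarrow> x \<bullet> y = 0"
      using span_not_UNIV_orthogonal by blast
    have "S \<subseteq> span (B \<union> W)" using B(2) span_mono[of B "B \<union> W"] by blast
    then have "x = 0"
      using orth span_superset[of "B \<union> W"] by (intro trivial) blast+
    with x show False by blast
  qed
  then have "DIM('a) = dim (B \<union> W)" by (metis dim_eq_full)
  also have "\<dots> \<le> card (B \<union> W)"
    using fin B(4) by (intro dim_le_card') (simp add: finiteI_independent)
  also have "\<dots> \<le> dim S + card W" using B(3) card_Un_le[of B W] by simp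
  finally show ?thesis .
qed

context cographic_representation
begin

lemma codim_le_2:
  assumes "\<And>x. (\<And>i j. s \<bullet> u i j = 0 \<Longrightarrow> t \<bullet> u i j = 0 \<Longrightarrow> x \<bullet> u i j = 0) \<Longrightarrow>
      x \<bullet> u p q = 0 \<Longrightarrow> x \<bullet> u p' q' = 0 \<Longrightarrow> x = 0"
  shows "DIM('a) \<le> dim {v \<in> V. s \<bullet> v = 0 \<and> t \<bullet> v = 0} + 2"
proof -
  have "DIM('a) \<le> dim {v \<in> V. s \<bullet> v = 0 \<and> t \<bullet> v = 0} + card {u p q, u p' q'}"
    by (rule DIM_le_dim_add_card) (auto intro!: assms)
  also have "card {u p q, u p' q'} \<le> 2" by (simp add: card_insert_if)
  finally show ?thesis by simp
qed

lemma codim_le_1: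
  assumes "\<And>x. (\<And>i j. s \<bullet> u i j = 0 \<Longrightarrow> x \<bullet> u i j = 0) \<Longrightarrow> x \<bullet> u p q = 0 \<Longrightarrow> x = 0"
  shows "DIM('a) \<le> dim {v \<in> V. s \<bullet> v = 0} + 1"
proof -
  have "DIM('a) \<le> dim {v \<in> V. s \<bullet> v = 0} + card {u p q}"
    by (rule DIM_le_dim_add_card) (auto intro!: assms)
  then show ?thesis by simp
qed

end

section \<open>Belts of the cographic zonotope with five vertices\<close>

text \<open>
  Read the variables as a flow on the five vertices \<open>a, b, c, d, e\<close>. The last two hypotheses say that
  at most one edge of the pentagram and at most one edge of the pentagon carries flow. Two edges
  contain no cycle, so the flow is zero.
\<close>

lemma K5_flow_on_two_edges_zero:
  fixes ab ac ad ae bc bd be cd ce de :: real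
  assumes "ab + ac + ad + ae = 0" "- ab + bc + bd + be = 0" "- ac - bc + cd + ce = 0"
    "- ad - bd - cd + de = 0" "- ae - be - ce - de = 0"
    and "(ce = 0 \<and> be = 0 \<and> bd = 0 \<and> ad = 0) \<or> (ac = 0 \<and> be = 0 \<and> bd = 0 \<and> ad = 0) \<or>
      (ac = 0 \<and> ce = 0 \<and> bd = 0 \<and> ad = 0) \<or> (ac = 0 \<and> ce = 0 \<and> be = 0 \<and> ad = 0) \<or>
      (ac = 0 \<and> ce = 0 \<and> be = 0 \<and> bd = 0)"
    and "(de = 0 \<and> cd = 0 \<and> bc = 0 \<and> ab = 0) \<or> (ae = 0 \<and> cd = 0 \<and> bc = 0 \<and> ab = 0) \<or>
      (ae = 0 \<and> de = 0 \<and> bc = 0 \<and> ab = 0) \<or> (ae = 0 \<and> de = 0 \<and> cd = 0 \<and> ab = 0) \<or>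
      (ae = 0 \<and> de = 0 \<and> cd = 0 \<and> bc = 0)"
  shows "ab = 0 \<and> ac = 0 \<and> ad = 0 \<and> ae = 0 \<and> bc = 0 \<and> bd = 0 \<and> be = 0 \<and> cd = 0 \<and> ce = 0 \<and> de = 0"
  using assms(6,7) assms(1-5) by (elim disjE conjE) simp_all

locale cographic_K5 = cographic_representation u
  for u :: "'v::finite \<Rightarrow> 'v \<Rightarrow> 'a::euclidean_space" +
  assumes card_vertices: "CARD('v) = 5" and dim_K5: "DIM('a) = 6"
begin

text \<open>
  The conservation laws in the ten edge coordinates of a circulation on five vertices, in the
  form needed for linear arithmetic.
\<close>

lemma Kirchhoff:
  assumes "UNIV = {a, b, c, d, e}" "distinct [a, b, c, d, e]"
  shows "x \<bullet> u a b + x \<bullet> u a c + x \<bullet> u a d + x \<bullet> u a e = 0"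
    "- (x \<bullet> u a b) + x \<bullet> u b c + x \<bullet> u b d + x \<bullet> u b e = 0"
    "- (x \<bullet> u a c) - x \<bullet> u b c + x \<bullet> u c d + x \<bullet> u c e = 0"
    "- (x \<bullet> u a d) - x \<bullet> u b d - x \<bullet> u c d + x \<bullet> u d e = 0"
    "- (x \<bullet> u a e) - x \<bullet> u b e - x \<bullet> u c e - x \<bullet> u d e = 0"
proof -
  have diag: "x \<bullet> u i i = 0" for i
  proof -
    have "x \<bullet> u i i = - (x \<bullet> u i i)" by (metis inner_minus_right u_antisym)
    then show ?thesis by linarith
  qed
  have anti: "x \<bullet> u b a = - (x \<bullet> u a b)" "x \<bullet> u c a = - (x \<bullet> u a c)" "x \<bullet> u d a = - (x \<bullet> u a d)"
    "x \<bullet> u e a = - (x \<bullet> u a e)" "x \<bullet> u c b = - (x \<bullet> u b c)" "x \<bullet> u d b = - (x \<bullet> u b d)"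
    "x \<bullet> u e b = - (x \<bullet> u b e)" "x \<bullet> u d c = - (x \<bullet> u c d)" "x \<bullet> u e c = - (x \<bullet> u c e)"
    "x \<bullet> u e d = - (x \<bullet> u d e)"
    by (metis inner_minus_right u_antisym)+
  have "x \<bullet> u i a + x \<bullet> u i b + x \<bullet> u i c + x \<bullet> u i d + x \<bullet> u i e = 0" for i
  proof -
    have "(\<Sum>j\<in>{a, b, c, d, e}. x \<bullet> u i j) = 0"
      using u_conserved[of i] by (simp flip: inner_sum_right add: assms(1))
    then show ?thesis using assms(2) by (simp add: add.assoc)
  qed
  from this[of a] this[of b] this[of c] this[of d] this[of e] diag anti
  show "x \<bullet> u a b + x \<bullet> u a c + x \<bullet> u a d + x \<bullet> u a e = 0"
    "- (x \<bullet> u a b) + x \<bullet> u b c + x \<bullet> u b d + x \<bullet> u b e = 0"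
    "- (x \<bullet> u a c) - x \<bullet> u b c + x \<bullet> u c d + x \<bullet> u c e = 0"
    "- (x \<bullet> u a d) - x \<bullet> u b d - x \<bullet> u c d + x \<bullet> u d e = 0"
    "- (x \<bullet> u a e) - x \<bullet> u b e - x \<bullet> u c e - x \<bullet> u d e = 0"
    by (simp_all add: diag)
qed

lemma eq_0_if_zero_on_K5_edges:
  assumes "UNIV = {a, b, c, d, e}"
    and z: "x \<bullet> u a b = 0" "x \<bullet> u a c = 0" "x \<bullet> u a d = 0" "x \<bullet> u a e = 0" "x \<bullet> u b c = 0"
      "x \<bullet> u b d = 0" "x \<bullet> u b e = 0" "x \<bullet> u c d = 0" "x \<bullet> u c e = 0" "x \<bullet> u d e = 0"
  shows "x = 0"
proof (rule eq_0_if_flow_0)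
  fix i j
  have anti: "x \<bullet> u q p = - (x \<bullet> u p q)" for p q by (metis inner_minus_right u_antisym)
  have "x \<bullet> u i j = 0 \<or> x \<bullet> u j i = 0 \<or> i = j"
    using z UNIV_I[of i] UNIV_I[of j] unfolding assms(1) by (elim insertE emptyE; hypsubst; simp)
  then show "x \<bullet> u i j = 0" using anti[of i j] by auto
qed

lemma distinct_extends_to_vertices:
  fixes xs :: "'v list"
  assumes "distinct xs"
  obtains ys where "distinct (xs @ ys)" "set (xs @ ys) = UNIV" "length xs + length ys = 5"
proof -
  obtain ys where ys: "set ys = UNIV - set xs" "distinct ys"
    using finite_distinct_list[of "UNIV - set xs"] by auto
  have "distinct (xs @ ys)" "set (xs @ ys) = UNIV" using assms ys by auto
  then have "length (xs @ ys) = 5" using distinct_card[of "xs @ ys"] card_vertices by simp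
  then show thesis using that[of ys] \<open>distinct (xs @ ys)\<close> \<open>set (xs @ ys) = UNIV\<close> by simp
qed

text \<open>
  The sign of \<open>s\<close> is immaterial for belts, so a triangle is recorded only through the edges that
  support it.
\<close>

definition triangle :: "'v set \<Rightarrow> 'a \<Rightarrow> bool" where
  "triangle A s \<longleftrightarrow> card A = 3 \<and> s \<noteq> 0 \<and> (\<forall>i j. s \<bullet> u i j = 0 \<longleftrightarrow> \<not> (i \<in> A \<and> j \<in> A \<and> i \<noteq> j))"

lemma triangle_exists:
  assumes "card A = 3"
  obtains s where "triangle A s"
proof -
  obtain a b c where A: "A = {a, b, c}" and dist: "a \<noteq> b" "a \<noteq> c" "b \<noteq> c"
    using assms by (auto simp: card_3_iff)
  obtain s where s: "\<And>i j. s \<bullet> u i j = cycle_flow [a, b, c] i j"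
    using u_universal[OF circulation_cycle_flow] by blast
  have "s \<bullet> u i j = 0 \<longleftrightarrow> \<not> (i \<in> A \<and> j \<in> A \<and> i \<noteq> j)" for i j
    unfolding s A using dist by (auto simp: cycle_flow_distinct cycle_edges_def)
  moreover have "s \<noteq> 0"
    using calculation[of a b] dist A by auto
  ultimately have "triangle A s" unfolding triangle_def using assms by blast
  then show thesis by (rule that)
qed

lemma triangle_dim:
  assumes "triangle A s"
  shows "DIM('a) \<le> dim {v \<in> V. s \<bullet> v = 0} + 1"
proof -
  obtain a b c where A: "A = {a, b, c}" and "a \<noteq> b" "a \<noteq> c" "b \<noteq> c"
    using assms by (auto simp: card_3_iff triangle_def)
  then have "distinct [a, b, c]" by simp
  then obtain ys where ys: "distinct ([a, b, c] @ ys)" "set ([a, b, c] @ ys) = UNIV" "length [a, b, c] + length ys = 5"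
    by (rule distinct_extends_to_vertices)
  then obtain d e where "ys = [d, e]"
    by (auto simp: numeral_eq_Suc length_Suc_conv)
  with ys have dist: "distinct [a, b, c, d, e]" and un: "UNIV = {a, b, c, d, e}" by auto
  show ?thesis
  proof (rule codim_le_1[where p = a and q = b])
    fix x assume x: "\<And>i j. s \<bullet> u i j = 0 \<Longrightarrow> x \<bullet> u i j = 0" and "x \<bullet> u a b = 0"
    have "x \<bullet> u i j = 0" if "i \<notin> A \<or> j \<notin> A" for i j
      using assms that by (intro x) (auto simp: triangle_def)
    then have "x \<bullet> u a d = 0" "x \<bullet> u a e = 0" "x \<bullet> u b d = 0" "x \<bullet> u b e = 0" "x \<bullet> u c d = 0" "x \<bullet> u c e = 0"
      "x \<bullet> u d e = 0"
      using dist A by auto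
    with \<open>x \<bullet> u a b = 0\<close> Kirchhoff[OF un dist, of x] show "x = 0"
      by (intro eq_0_if_zero_on_K5_edges[OF un]) linarith+
  qed
qed

text \<open>
  Two triangles in a graph with five vertices share a vertex, so their union has at most two
  independent cycles: if they differ, deleting one private edge from each leaves a forest.
\<close>

lemma triangles_dim:
  assumes "triangle A s" "triangle B t"
  shows "DIM('a) \<le> dim {v \<in> V. s \<bullet> v = 0 \<and> t \<bullet> v = 0} + 2"
proof -
  have cards: "card A = 3" "card B = 3" using assms by (auto simp: triangle_def)
  have "card (A \<union> B) \<le> 5" using card_mono[of UNIV "A \<union> B"] card_vertices by simp
  moreover have "card A + card B = card (A \<union> B) + card (A \<inter> B)" by (rule card_Un_Int) auto
  moreover have "card (A \<inter> B) \<le> card A" by (intro card_mono) auto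
  ultimately consider "card (A \<inter> B) = 1" | "card (A \<inter> B) = 2" | "card (A \<inter> B) = 3"
    using cards by linarith
  then show ?thesis
  proof cases
    case 1
    then obtain a where a: "A \<inter> B = {a}" by (rule card_1_singletonE)
    have "card (A - B) = 2" "card (B - A) = 2"
      using 1 cards card_Diff_subset_Int[of A B] card_Diff_subset_Int[of B A] by (auto simp: Int_commute)
    then obtain b c d e where bc: "A - B = {b, c}" "b \<noteq> c" and de: "B - A = {d, e}" "d \<noteq> e"
      by (auto simp: card_2_iff)
    have A: "A = {a, b, c}" and B: "B = {a, d, e}" using a bc de by auto
    have dist: "distinct [a, b, c, d, e]" using a bc de by auto
    then have "card {a, b, c, d, e} = CARD('v)" using card_vertices by simp
    then have un: "UNIV = {a, b, c, d, e}" by (metis card_subset_eq finite subset_UNIV)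
    show ?thesis
    proof (rule codim_le_2[where p = b and q = c and p' = d and q' = e])
      fix x assume x: "\<And>i j. s \<bullet> u i j = 0 \<Longrightarrow> t \<bullet> u i j = 0 \<Longrightarrow> x \<bullet> u i j = 0"
        and x0: "x \<bullet> u b c = 0" "x \<bullet> u d e = 0"
      have "x \<bullet> u i j = 0" if "i \<notin> A \<or> j \<notin> A" "i \<notin> B \<or> j \<notin> B" for i j
        using assms that by (intro x) (auto simp: triangle_def)
      then have "x \<bullet> u b d = 0" "x \<bullet> u b e = 0" "x \<bullet> u c d = 0" "x \<bullet> u c e = 0"
        using dist A B by auto
      with x0 Kirchhoff[OF un dist, of x] show "x = 0"
        by (intro eq_0_if_zero_on_K5_edges[OF un]) linarith+
    qed
  next
    case 2
    then obtain a b where ab: "A \<inter> B = {a, b}" "a \<noteq> b" by (auto simp: card_2_iff)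
    have "card (A - B) = 1" "card (B - A) = 1"
      using 2 cards card_Diff_subset_Int[of A B] card_Diff_subset_Int[of B A] by (auto simp: Int_commute)
    then obtain c d where c: "A - B = {c}" and d: "B - A = {d}"
      by (metis card_1_singletonE)
    have A: "A = {a, b, c}" and B: "B = {a, b, d}" using ab c d by auto
    have "distinct [a, b, c, d]" using ab c d by auto
    then obtain ys where ys: "distinct ([a, b, c, d] @ ys)" "set ([a, b, c, d] @ ys) = UNIV" "length [a, b, c, d] + length ys = 5"
      by (rule distinct_extends_to_vertices)
    then obtain e where "ys = [e]"
      by (auto simp: numeral_eq_Suc length_Suc_conv)
    with ys have dist: "distinct [a, b, c, d, e]" and un: "UNIV = {a, b, c, d, e}" by auto
    show ?thesis
    proof (rule codim_le_2[where p = a and q = c and p' = a and q' = d])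
      fix x assume x: "\<And>i j. s \<bullet> u i j = 0 \<Longrightarrow> t \<bullet> u i j = 0 \<Longrightarrow> x \<bullet> u i j = 0"
        and x0: "x \<bullet> u a c = 0" "x \<bullet> u a d = 0"
      have "x \<bullet> u i j = 0" if "i \<notin> A \<or> j \<notin> A" "i \<notin> B \<or> j \<notin> B" for i j
        using assms that by (intro x) (auto simp: triangle_def)
      then have "x \<bullet> u a e = 0" "x \<bullet> u b e = 0" "x \<bullet> u c d = 0" "x \<bullet> u c e = 0" "x \<bullet> u d e = 0"
        using dist A B by auto
      with x0 Kirchhoff[OF un dist, of x] show "x = 0"
        by (intro eq_0_if_zero_on_K5_edges[OF un]) linarith+
    qed
  next
    case 3
    then have "A \<inter> B = A" "A \<inter> B = B" using cards by (metis card_subset_eq finite inf_le1 inf_le2)+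
    then have "t \<bullet> u i j = 0 \<longleftrightarrow> s \<bullet> u i j = 0" for i j using assms by (simp add: triangle_def)
    then have "{v \<in> V. s \<bullet> v = 0 \<and> t \<bullet> v = 0} = {v \<in> V. s \<bullet> v = 0}" by auto
    then show ?thesis using triangle_dim[OF assms(1)] by simp
  qed
qed

text \<open>
  A cycle of length 4 or 5 together with the chord joining two vertices at distance 2 has two
  independent cycles, one of them a triangle. This is the place where the bound 5 on the length of
  a cycle enters.
\<close>

lemma cycle_triangle_dim:
  assumes xs: "distinct xs" "3 \<le> length xs" and t: "\<And>i j. t \<bullet> u i j = cycle_flow xs i j"
  obtains A s where "triangle A s" "DIM('a) \<le> dim {v \<in> V. t \<bullet> v = 0 \<and> s \<bullet> v = 0} + 2"
proof -
  obtain a b c ys where xs_eq: "xs = a # b # c # ys"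
    using xs(2) by (auto simp: numeral_eq_Suc Suc_le_length_iff)
  have abc: "distinct [a, b, c]" using xs(1) by (simp add: xs_eq)
  then have "card {a, b, c} = 3" by simp
  then obtain s where s: "triangle {a, b, c} s" by (rule triangle_exists)
  have s0: "s \<bullet> u i j = 0" if "i \<notin> {a, b, c} \<or> j \<notin> {a, b, c}" for i j
    using s that by (auto simp: triangle_def)
  obtain zs where zs: "distinct (xs @ zs)" "set (xs @ zs) = UNIV" "length xs + length zs = 5"
    using distinct_extends_to_vertices[OF xs(1)] .
  define ws where "ws = ys @ zs"
  have "length ws = 2" using zs(3) by (simp add: xs_eq ws_def)
  then obtain d e where "ws = [d, e]"
    by (auto simp: numeral_eq_Suc length_Suc_conv)
  then have de: "ys @ zs = [d, e]" by (simp add: ws_def)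
  then have "xs @ zs = [a, b, c, d, e]" by (simp add: xs_eq)
  with zs have dist: "distinct [a, b, c, d, e]" and un: "UNIV = {a, b, c, d, e}" by auto
  consider "ys = []" | "ys = [d]" | "ys = [d, e]"
    using de by (auto simp: append_eq_Cons_conv)
  then have "DIM('a) \<le> dim {v \<in> V. t \<bullet> v = 0 \<and> s \<bullet> v = 0} + 2"
  proof cases
    case 1
    show ?thesis
    proof (rule codim_le_2[where p = a and q = b and p' = a and q' = b])
      fix x assume x: "\<And>i j. t \<bullet> u i j = 0 \<Longrightarrow> s \<bullet> u i j = 0 \<Longrightarrow> x \<bullet> u i j = 0"
        and x0: "x \<bullet> u a b = 0"
      have "x \<bullet> u a d = 0" "x \<bullet> u a e = 0" "x \<bullet> u b d = 0" "x \<bullet> u b e = 0" "x \<bullet> u c d = 0" "x \<bullet> u c e = 0"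
        "x \<bullet> u d e = 0"
        using dist by (auto intro!: x s0 simp: t xs_eq 1 cycle_flow_distinct cycle_edges_def)
      with x0 Kirchhoff[OF un dist, of x] show "x = 0"
        by (intro eq_0_if_zero_on_K5_edges[OF un]) linarith+
    qed
  next
    case 2
    show ?thesis
    proof (rule codim_le_2[where p = a and q = b and p' = c and q' = d])
      fix x assume x: "\<And>i j. t \<bullet> u i j = 0 \<Longrightarrow> s \<bullet> u i j = 0 \<Longrightarrow> x \<bullet> u i j = 0"
        and x0: "x \<bullet> u a b = 0" "x \<bullet> u c d = 0"
      have "x \<bullet> u a e = 0" "x \<bullet> u b d = 0" "x \<bullet> u b e = 0" "x \<bullet> u c e = 0" "x \<bullet> u d e = 0"
        using dist by (auto intro!: x s0 simp: t xs_eq 2 cycle_flow_distinct cycle_edges_def)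
      with x0 Kirchhoff[OF un dist, of x] show "x = 0"
        by (intro eq_0_if_zero_on_K5_edges[OF un]) linarith+
    qed
  next
    case 3
    show ?thesis
    proof (rule codim_le_2[where p = a and q = b and p' = c and q' = d])
      fix x assume x: "\<And>i j. t \<bullet> u i j = 0 \<Longrightarrow> s \<bullet> u i j = 0 \<Longrightarrow> x \<bullet> u i j = 0"
        and x0: "x \<bullet> u a b = 0" "x \<bullet> u c d = 0"
      have "x \<bullet> u a d = 0" "x \<bullet> u b d = 0" "x \<bullet> u b e = 0" "x \<bullet> u c e = 0"
        using dist by (auto intro!: x s0 simp: t xs_eq 3 cycle_flow_distinct cycle_edges_def)
      with x0 Kirchhoff[OF un dist, of x] show "x = 0"
        by (intro eq_0_if_zero_on_K5_edges[OF un]) linarith+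
    qed
  qed
  with s show thesis by (rule that)
qed

abbreviation "Z \<equiv> minkowski_zonotope V"

lemma finite_V: "finite V" by simp

lemma two_le_dim: "2 \<le> DIM('a)" by (simp add: dim_K5)

text \<open>
  The normal of a facet is proportional to the flow of a simple cycle \<open>t\<close> in its support: the functional
  \<open>t\<close> vanishes on all generators orthogonal to the normal, and those span a hyperplane.
\<close>

lemma facet_near_triangle:
  assumes F: "F facet_of Z"
  obtains A s M where "triangle A s" "M facet_of Z" "direction_space M = {x. s \<bullet> x = 0}" "share_belt Z F M"
proof -
  obtain a where a: "a \<noteq> 0" "dim {v \<in> V. a \<bullet> v = 0} + 1 = DIM('a)" "direction_space F = {x. a \<bullet> x = 0}"
    using facet_hyperplane[OF finite_V u_spanning F] .
  obtain xs t where xs: "distinct xs" "3 \<le> length xs" and t: "t \<noteq> 0" "\<And>i j. t \<bullet> u i j = cycle_flow xs i j"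
    and conf: "\<And>i j. t \<bullet> u i j = 0 \<or> t \<bullet> u i j = sgn (a \<bullet> u i j)"
    using cycle_in_support[OF a(1)] by blast
  have "{v \<in> V. a \<bullet> v = 0} \<subseteq> {v \<in> V. t \<bullet> v = 0}"
    using conf by auto (metis sgn_0)
  then have "span {v \<in> V. a \<bullet> v = 0} \<subseteq> {x. t \<bullet> x = 0}"
    by (intro span_minimal) (auto simp: subspace_hyperplane)
  then have "{x. a \<bullet> x = 0} \<subseteq> {x. t \<bullet> x = 0}"
    using a by (simp add: span_zero_inner_eq_hyperplane)
  then have "{x. a \<bullet> x = 0} = {x. t \<bullet> x = 0}"
    using a(1) t(1) by (intro subspace_dim_equal) (simp_all add: subspace_hyperplane dim_hyperplane)
  then have dF: "direction_space F = {x. t \<bullet> x = 0}" using a(3) by simp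
  obtain A s where s: "triangle A s" and dim: "DIM('a) \<le> dim {v \<in> V. t \<bullet> v = 0 \<and> s \<bullet> v = 0} + 2"
    using cycle_triangle_dim[OF xs t(2)] .
  have "s \<noteq> 0" using s by (simp add: triangle_def)
  then obtain M where M: "M facet_of Z" "direction_space M = {x. s \<bullet> x = 0}"
    using zonotope_facetI[OF finite_V u_spanning _ triangle_dim[OF s]] by blast
  have "share_belt Z F M"
    using share_beltI[OF finite_V u_spanning two_le_dim F M(1) dF t(1) M(2) \<open>s \<noteq> 0\<close> dim] .
  with s M show thesis by (intro that)
qed

text \<open>
  From each facet one belt leads to a triangle facet, and any two triangle facets share a belt.
\<close>

lemma belt_distance_Z_le_3:
  assumes "F facet_of Z" "G facet_of Z"
  shows "belt_distance Z F G \<le> 3"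
proof -
  obtain A s M where M: "triangle A s" "M facet_of Z" "direction_space M = {x. s \<bullet> x = 0}" "share_belt Z F M"
    using facet_near_triangle[OF assms(1)] .
  obtain B t N where N: "triangle B t" "N facet_of Z" "direction_space N = {x. t \<bullet> x = 0}" "share_belt Z G N"
    using facet_near_triangle[OF assms(2)] .
  have "s \<noteq> 0" "t \<noteq> 0" using M(1) N(1) by (simp_all add: triangle_def)
  then have "share_belt Z M N"
    using share_beltI[OF finite_V u_spanning two_le_dim M(2) N(2) M(3) _ N(3) _ triangles_dim[OF M(1) N(1)]]
    by blast
  moreover have "share_belt Z N G" using N(4) by (auto simp: share_belt_def)
  ultimately show ?thesis using M(4) by (intro belt_distance_le_3)
qed

text \<open>
  If \<open>p\<close> vanishes only on the edges \<open>es\<close>, the generators orthogonal to \<open>p\<close> and \<open>c\<close> are, up to sign, those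
  edges of \<open>es\<close> on which \<open>c\<close> vanishes.
\<close>

lemma dim_le_zero_edges:
  assumes "\<And>i j. p \<bullet> u i j = 0 \<Longrightarrow> i = j \<or> (i, j) \<in> set es \<or> (j, i) \<in> set es"
  shows "dim {v \<in> V. p \<bullet> v = 0 \<and> c \<bullet> v = 0} \<le> length (filter (\<lambda>(i, j). c \<bullet> u i j = 0) es)"
proof -
  let ?es = "filter (\<lambda>(i, j). c \<bullet> u i j = 0) es"
  let ?W = "case_prod u ` set ?es"
  have "{v \<in> V. p \<bullet> v = 0 \<and> c \<bullet> v = 0} \<subseteq> span ?W"
  proof clarify
    fix i j assume p: "p \<bullet> u i j = 0" and c: "c \<bullet> u i j = 0"
    consider "i = j" | "(i, j) \<in> set es" | "(j, i) \<in> set es" using assms[OF p] by blast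
    then show "u i j \<in> span ?W"
    proof cases
      case 1
      have "u i i = - u i i" by (rule u_antisym)
      then have "2 *\<^sub>R u i i = 0" unfolding scaleR_2 by (simp only: eq_neg_iff_add_eq_0)
      then show ?thesis using 1 by (simp add: span_zero)
    next
      case 2
      then have "u i j \<in> ?W" using c by force
      then show ?thesis by (rule span_base)
    next
      case 3
      moreover have "c \<bullet> u j i = 0" using c by (simp add: u_antisym[of j i])
      ultimately have "u j i \<in> ?W" by force
      then show ?thesis unfolding u_antisym[of i j] by (intro span_neg span_base)
    qed
  qed
  then have "dim {v \<in> V. p \<bullet> v = 0 \<and> c \<bullet> v = 0} \<le> card ?W" by (intro dim_le_card) auto
  also have "\<dots> \<le> card (set ?es)" by (rule card_image_le) simp
  also have "\<dots> \<le> length ?es" by (rule card_length)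
  finally show ?thesis .
qed

lemma five_cycle_zero_edges:
  assumes un: "UNIV = {a, b, c, d, e}" and dist: "distinct [a, b, c, d, e]"
    and t: "\<And>i j. t \<bullet> u i j = cycle_flow [a, b, c, d, e] i j" and ij: "t \<bullet> u i j = 0"
  shows "i = j \<or> (i, j) \<in> set [(a, c), (c, e), (e, b), (b, d), (d, a)] \<or>
    (j, i) \<in> set [(a, c), (c, e), (e, b), (b, d), (d, a)]"
proof -
  let ?C = "{(a, b), (b, c), (c, d), (d, e), (e, a)}"
  have "t \<bullet> u k l = 1" if "(k, l) \<in> ?C" for k l
    using that dist unfolding t by (auto simp: cycle_flow_distinct cycle_edges_def)
  moreover have "t \<bullet> u i j = - (t \<bullet> u j i)" by (metis inner_minus_right u_antisym)
  ultimately have "(i, j) \<notin> ?C" "(j, i) \<notin> ?C" using ij by force+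
  moreover have "k = a \<or> k = b \<or> k = c \<or> k = d \<or> k = e" for k using un by blast
  from this[of i] this[of j]
  have "i = j \<or> (i, j) \<in> ?C \<or> (j, i) \<in> ?C \<or> (i, j) \<in> set [(a, c), (c, e), (e, b), (b, d), (d, a)] \<or>
      (j, i) \<in> set [(a, c), (c, e), (e, b), (b, d), (d, a)]"
    by (elim disjE; hypsubst; simp)
  ultimately show ?thesis by blast
qed

lemma five_cycle_facet:
  assumes un: "UNIV = {a, b, c, d, e}" and dist: "distinct [a, b, c, d, e]"
    and t: "\<And>i j. t \<bullet> u i j = cycle_flow [a, b, c, d, e] i j"
  obtains F where "F facet_of Z" "direction_space F = {x. t \<bullet> x = 0}"
proof -
  have "t \<bullet> u a b = 1"
    unfolding t using dist by (auto simp: cycle_flow_distinct cycle_edges_def)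
  then have "t \<noteq> 0" by auto
  moreover have "DIM('a) \<le> dim {v \<in> V. t \<bullet> v = 0} + 1"
  proof (rule codim_le_1[where p = a and q = b])
    fix x assume x: "\<And>i j. t \<bullet> u i j = 0 \<Longrightarrow> x \<bullet> u i j = 0" and x0: "x \<bullet> u a b = 0"
    have "x \<bullet> u a c = 0" "x \<bullet> u a d = 0" "x \<bullet> u b d = 0" "x \<bullet> u b e = 0" "x \<bullet> u c e = 0"
      using dist by (auto intro!: x simp: t cycle_flow_distinct cycle_edges_def)
    with x0 Kirchhoff[OF un dist, of x] show "x = 0"
      by (intro eq_0_if_zero_on_K5_edges[OF un]) linarith+
  qed
  ultimately show thesis using zonotope_facetI[OF finite_V u_spanning] that by blast
qed

text \<open>
  A belt through the facet of a Hamiltonian cycle leads only to cycles using at most one of the five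
  edges off that cycle.
\<close>

lemma five_cycle_neighbour:
  assumes un: "UNIV = {a, b, c, d, e}" and dist: "distinct [a, b, c, d, e]"
    and t: "\<And>i j. t \<bullet> u i j = cycle_flow [a, b, c, d, e] i j"
    and belt: "share_belt Z F M" "direction_space F = {x. t \<bullet> x = 0}" "direction_space M = {x. h \<bullet> x = 0}"
  shows "4 \<le> length (filter (\<lambda>(i, j). h \<bullet> u i j = 0) [(a, c), (c, e), (e, b), (b, d), (d, a)])"
proof -
  have "4 \<le> dim {v \<in> V. t \<bullet> v = 0 \<and> h \<bullet> v = 0}"
    using share_belt_dim[OF finite_V u_spanning belt] by (simp add: dim_K5)
  also note dim_le_zero_edges[OF five_cycle_zero_edges[OF un dist t]]
  finally show ?thesis .
qed

lemma four_of_five: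
  assumes "4 \<le> length (filter P [x1, x2, x3, x4, x5])"
  shows "(P x2 \<and> P x3 \<and> P x4 \<and> P x5) \<or> (P x1 \<and> P x3 \<and> P x4 \<and> P x5) \<or> (P x1 \<and> P x2 \<and> P x4 \<and> P x5)
    \<or> (P x1 \<and> P x2 \<and> P x3 \<and> P x5) \<or> (P x1 \<and> P x2 \<and> P x3 \<and> P x4)"
  using assms by (simp split: if_splits)

text \<open>
  The pentagon and the pentagram are complementary Hamiltonian cycles. A facet sharing belts with both
  would be a cycle with at most one edge in each of them.
\<close>

lemma ex_belt_distance_ge_3:
  obtains F G where "F facet_of Z" "G facet_of Z" "3 \<le> belt_distance Z F G"
proof -
  obtain ys :: "'v list" where ys: "distinct ys" "set ys = UNIV" "length ys = 5"
    using distinct_extends_to_vertices[of "[]"] by auto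
  obtain a b c d e where "ys = [a, b, c, d, e]"
    using ys(3) by (auto simp: numeral_eq_Suc length_Suc_conv)
  with ys have dist: "distinct [a, b, c, d, e]" and un: "UNIV = {a, b, c, d, e}" by auto
  then have dist': "distinct [a, c, e, b, d]" and un': "UNIV = {a, c, e, b, d}" by auto
  obtain p where p: "\<And>i j. p \<bullet> u i j = cycle_flow [a, b, c, d, e] i j"
    using u_universal[OF circulation_cycle_flow] by blast
  obtain q where q: "\<And>i j. q \<bullet> u i j = cycle_flow [a, c, e, b, d] i j"
    using u_universal[OF circulation_cycle_flow] by blast
  obtain F where F: "F facet_of Z" "direction_space F = {x. p \<bullet> x = 0}"
    using five_cycle_facet[OF un dist p] .
  obtain G where G: "G facet_of Z" "direction_space G = {x. q \<bullet> x = 0}"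
    using five_cycle_facet[OF un' dist' q] .
  have no_mid: False if "share_belt Z F M" "share_belt Z M G" for M
  proof -
    have "M facet_of Z" using that(1) by (auto simp: share_belt_def belts_def belt_def)
    then obtain h where h: "h \<noteq> 0" "direction_space M = {x. h \<bullet> x = 0}"
      using facet_hyperplane[OF finite_V u_spanning] by metis
    have "share_belt Z G M" using that(2) by (auto simp: share_belt_def)
    note pent = four_of_five[OF five_cycle_neighbour[OF un dist p that(1) F(2) h(2)], unfolded prod.case]
      and star = four_of_five[OF five_cycle_neighbour[OF un' dist' q this G(2) h(2)], unfolded prod.case]
    have anti: "h \<bullet> u j i = - (h \<bullet> u i j)" for i j by (metis inner_minus_right u_antisym)
    note reverse = anti[of e b] anti[of d a] anti[of e d] anti[of d c] anti[of c b] anti[of b a]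
    have "h \<bullet> u a b = 0 \<and> h \<bullet> u a c = 0 \<and> h \<bullet> u a d = 0 \<and> h \<bullet> u a e = 0 \<and> h \<bullet> u b c = 0 \<and>
        h \<bullet> u b d = 0 \<and> h \<bullet> u b e = 0 \<and> h \<bullet> u c d = 0 \<and> h \<bullet> u c e = 0 \<and> h \<bullet> u d e = 0"
      using pent star unfolding reverse neg_equal_0_iff_equal
      by (rule K5_flow_on_two_edges_zero[OF Kirchhoff[OF un dist]])
    then have "h = 0" by (intro eq_0_if_zero_on_K5_edges[OF un]) blast+
    with h(1) show False by blast
  qed
  have refl: "share_belt Z G G" using share_belt_if_parallel[OF finite_V u_spanning two_le_dim G(1) G(1)] by simp
  have "\<not> opposite_facets Z F G"
  proof
    assume "opposite_facets Z F G"
    then have "share_belt Z F G"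
      using share_belt_if_parallel[OF finite_V u_spanning two_le_dim F(1) G(1)] opposite_facets_direction_space by metis
    with refl show False using no_mid by blast
  qed
  then have "3 \<le> belt_distance Z F G" using refl no_mid by (rule belt_distance_ge_3)
  with F G show thesis by (intro that)
qed

lemma belt_diameter_Z: "belt_diameter Z = 3"
proof (rule antisym)
  show "belt_diameter Z \<le> 3"
    unfolding belt_diameter_def by (intro Sup_least) (use belt_distance_Z_le_3 in blast)
  obtain F G where FG: "F facet_of Z" "G facet_of Z" "3 \<le> belt_distance Z F G"
    by (rule ex_belt_distance_ge_3)
  then have "belt_distance Z F G \<le> belt_diameter Z"
    unfolding belt_diameter_def by (intro Sup_upper) blast
  with FG(3) show "3 \<le> belt_diameter Z" by (rule order_trans)
qed

lemma space_filling_Z: "space_filling_zonotope Z"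
proof -
  have "zonotope Z" unfolding zonotope_def by (intro exI[of _ V] exI[of _ 0]) (simp add: finite_V)
  moreover have "dim V = DIM('a)" using u_spanning by (simp add: dim_eq_full)
  ultimately show ?thesis
    using regular_zonotope_tiles[OF edge_vectors_regular] polytope_minkowski_zonotope[OF finite_V]
    by (auto simp: space_filling_zonotope_def parallelohedron_def aff_dim_minkowski_zonotope)
qed

end

theorem theorem4p7:
  shows "(\<exists>Z::(real^6) set. space_filling_zonotope Z \<and> aff_dim Z = 6 \<and> belt_diameter Z = 3) \<and>
    \<lceil>log 2 (real DIM(real^6))\<rceil> = 3 \<and>
    \<lceil>log 2 (4/5 * real DIM(real^6))\<rceil> = 3 \<and>
    (\<exists>Z::(real^6) set. space_filling_zonotope Z \<and>
       belt_diameter Z = enat (nat \<lceil>log 2 (real DIM(real^6))\<rceil>)) \<and>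
    (\<exists>Z::(real^6) set. space_filling_zonotope Z \<and>
       belt_diameter Z = enat (nat \<lceil>log 2 (4/5 * real DIM(real^6))\<rceil>))"
proof -
  have "card {(i, j). i < (j :: 4)} = 6" using card_strict_pairs[where 'n = 4] by simp
  then obtain u :: "4 option \<Rightarrow> 4 option \<Rightarrow> real^6" where "cographic_representation u"
    using cographic_representation_exists[where 'n = 4 and 'a = "real^6"] by auto
  then interpret cographic_K5 u
    by (simp add: cographic_K5_def cographic_K5_axioms_def)
  have Z: "space_filling_zonotope Z" "aff_dim Z = 6" "belt_diameter Z = 3"
    using space_filling_Z belt_diameter_Z by (auto simp: space_filling_zonotope_def parallelohedron_def)
  have log: "\<lceil>log 2 x\<rceil> = 3" if "4 < x" "x \<le> 8" for x :: real
  proof -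
    have "2 < log 2 x" using that less_log_iff[of 2 x 2] by simp
    moreover have "log 2 x \<le> 3" using that log_le_iff[of 2 x 3] by simp
    ultimately show ?thesis by (intro ceiling_unique) auto
  qed
  have logs: "\<lceil>log 2 (real DIM(real^6))\<rceil> = 3" "\<lceil>log 2 (4/5 * real DIM(real^6))\<rceil> = 3"
    by (rule log; simp)+
  show ?thesis
    unfolding logs using Z by (auto simp: numeral_eq_enat)
qed

end
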